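(* Let $G$ be a countable sofic group and let $(K_1,\kappa_1)$, $(K_2,\kappa_2)$ be standard Borel probability spaces such that $H(\kappa_1)+H(\kappa_2)<\infty$. If $(G,K_1^G,\kappa_1^G)$ is conjugate up to automorphisms to $(G,K_2^G,\kappa_2^G)$, then $H(\kappa_1)=H(\kappa_2)$.
   Context: A countable group $G$ is sofic if there is a sequence of maps $\sigma_i:G\to\mathrm{Sym}(m_i)$ (not necessarily homomorphisms) and finite sets $F_1\subset F_2\subset\cdots$ with $\bigcup_iF_i=G$ and $\epsilon_i\to0$ such that for each $i$ the set of $v\in\{1,\dots,m_i\}$ with $\sigma_i(f_1)\sigma_i(f_2)v=\sigma_i(f_1f_2)v$ for all $f_1,f_2\in F_i$ and $\sigma_i(f_1)v\neq\sigma_i(f_2)v$ for distinct $f_1,f_2\in F_i$ has at least $(1-\epsilon_i)m_i$ elements. The Bernoulli shift $(G,K^G,\kappa^G)$ is the action $(gx)(f)=x(g^{-1}f)$ on $K^G$ with product measure. $H(\kappa)=-\sum_k\kappa(\{k\})\log\kappa(\{k\})$ if $\kappa$ is supported on a countable set, else $+\infty$. Two systems $(G_1,X_1,\mu_1)$ and $(G_2,X_2,\mu_2)$ are conjugate up to automorphisms if there exist a group isomorphism $\Phi:G_1\to G_2$, conull sets $X_i'\subset X_i$ and a measure-space isomorphism $\phi:X_1'\to X_2'$ with $\phi(gx)=\Phi(g)\phi(x)$ for all $g\in G_1$, $x\in X_1'$. *)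

theory Defs
  imports "HOL-Probability.Probability" "HOL-Combinatorics.Permutations"
begin

text \<open>Groups are written additively (type class group_add, NOT assumed commutative).
  Sofic groups: maps sigma_i : G -> Sym({1..m_i}), finite sets F_i increasing and
  exhausting G, epsilon_i -> 0, and the good-vertex condition.\<close>

definition sofic :: "'g::group_add itself \<Rightarrow> bool" where
  "sofic _ \<longleftrightarrow>
    (\<exists>(m :: nat \<Rightarrow> nat) (\<sigma> :: nat \<Rightarrow> 'g \<Rightarrow> nat \<Rightarrow> nat) (F :: nat \<Rightarrow> 'g set) (\<epsilon> :: nat \<Rightarrow> real).
       (\<forall>i. m i \<ge> 1) \<and>
       (\<forall>i g. \<sigma> i g permutes {1..m i}) \<and>
       (\<forall>i. finite (F i)) \<and> (\<forall>i. F i \<subseteq> F (Suc i)) \<and> (\<Union>i. F i) = UNIV \<and>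
       \<epsilon> \<longlonglongrightarrow> 0 \<and>
       (\<forall>i. real (card {v \<in> {1..m i}.
                 (\<forall>f1\<in>F i. \<forall>f2\<in>F i. \<sigma> i f1 (\<sigma> i f2 v) = \<sigma> i (f1 + f2) v) \<and>
                 (\<forall>f1\<in>F i. \<forall>f2\<in>F i. f1 \<noteq> f2 \<longrightarrow> \<sigma> i f1 v \<noteq> \<sigma> i f2 v)})
            \<ge> (1 - \<epsilon> i) * real (m i)))"

definition std_borel_prob :: "'k::polish_space measure \<Rightarrow> bool" where
  "std_borel_prob \<kappa> \<longleftrightarrow> sets \<kappa> = sets borel \<and> prob_space \<kappa>"

definition shannon_entropy :: "'k measure \<Rightarrow> ennreal" where
  "shannon_entropy \<kappa> =
     (if \<exists>C. countable C \<and> C \<in> sets \<kappa> \<and> emeasure \<kappa> C = 1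
      then (\<integral>\<^sup>+ k. ennreal (- measure \<kappa> {k} * ln (measure \<kappa> {k})) \<partial>count_space UNIV)
      else \<infinity>)"

definition bernoulli_measure :: "'k measure \<Rightarrow> ('g \<Rightarrow> 'k) measure" where
  "bernoulli_measure \<kappa> = PiM UNIV (\<lambda>_. \<kappa>)"

definition shift :: "'g::group_add \<Rightarrow> ('g \<Rightarrow> 'k) \<Rightarrow> ('g \<Rightarrow> 'k)" where
  "shift g x = (\<lambda>f. x (- g + f))"

definition group_automorphism :: "('g::group_add \<Rightarrow> 'g) \<Rightarrow> bool" where
  "group_automorphism \<Phi> \<longleftrightarrow> bij \<Phi> \<and> (\<forall>a b. \<Phi> (a + b) = \<Phi> a + \<Phi> b)"

definition measure_space_iso :: "'a measure \<Rightarrow> 'b measure \<Rightarrow> 'a set \<Rightarrow> 'b set \<Rightarrow> ('a \<Rightarrow> 'b) \<Rightarrow> bool" where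
  "measure_space_iso M N X Y \<phi> \<longleftrightarrow>
     X \<in> sets M \<and> Y \<in> sets N \<and> bij_betw \<phi> X Y \<and>
     \<phi> \<in> measurable (restrict_space M X) (restrict_space N Y) \<and>
     the_inv_into X \<phi> \<in> measurable (restrict_space N Y) (restrict_space M X) \<and>
     (\<forall>A \<in> sets M. A \<subseteq> X \<longrightarrow> emeasure N (\<phi> ` A) = emeasure M A)"

definition conj_up_to_aut ::
  "('g::group_add \<Rightarrow> 'a \<Rightarrow> 'a) \<Rightarrow> 'a measure \<Rightarrow> ('g \<Rightarrow> 'b \<Rightarrow> 'b) \<Rightarrow> 'b measure \<Rightarrow> bool" where
  "conj_up_to_aut act1 \<mu>1 act2 \<mu>2 \<longleftrightarrow>
     (\<exists>\<Phi> X1 X2 \<phi>. group_automorphism \<Phi> \<and>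
        X1 \<in> sets \<mu>1 \<and> emeasure \<mu>1 (space \<mu>1 - X1) = 0 \<and>
        X2 \<in> sets \<mu>2 \<and> emeasure \<mu>2 (space \<mu>2 - X2) = 0 \<and>
        measure_space_iso \<mu>1 \<mu>2 X1 X2 \<phi> \<and>
        (\<forall>g. \<forall>x\<in>X1. act1 g x \<in> X1 \<and> \<phi> (act1 g x) = act2 (\<Phi> g) (\<phi> x)))"

end

theory Submission
  imports Defs "HOL-Real_Asymp.Real_Asymp"
begin

text \<open>
  A conjugacy makes the time-zero coordinate of one shift an observable \<open>b\<close> of the other,
  whose translates determine the point \<open>x\<close> almost surely. It therefore suffices to show
  \<open>H(\<kappa>\<^sub>1) \<le> H(b)\<close> for every such generating observable and to use the conjugacy in both
  directions.

  Approximate \<open>b\<close> by a finite-valued function \<open>B\<close> of finitely many coordinates. On a sofic model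
  with vertex set \<open>V\<close> take i.i.d. labels \<open>x\<^sub>v\<close> with law \<open>\<kappa>\<^sub>1\<close> and let \<open>y\<^sub>v\<close> be \<open>B\<close> applied to the
  labels seen from \<open>v\<close>. Since \<open>x\<^sub>v\<close> is nearly determined by the values of \<open>y\<close> near a good vertex \<open>v\<close>,
  the chain rule and subadditivity of Shannon entropy give
  \<open>|V| H(\<kappa>\<^sub>1) = H(x) \<le> H(y) + H(x | y) \<le> (\<Sum>v. H(y\<^sub>v)) + (\<Sum>v. H(x\<^sub>v | y)) \<approx> |V| H(b)\<close>.
  Truncating the alphabets makes all random variables finite-valued, so the errors vanish by
  continuity of entropy.
\<close>

section \<open>Entropy of finite-valued random variables\<close>

text \<open>No notion of sofic entropy is used: each model contributes only Shannon entropies of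
  finite-valued variables, and conditional entropy is always the difference
  \<open>ent M (\<lambda>x. (X x, Y x)) - ent M Y\<close>. The obstacle is that neither
  \<open>b\<close> nor the decoder \<open>c\<close>, which recovers \<open>u 0\<close> from the
  translates of \<open>b\<close>, need be local or bounded, while continuity of entropy is available
  only on a fixed finite alphabet. This dictates the order of limits. The truncation
  \<open>N\<close> of the unknown label stays fixed. The decoder is replaced by a function of
  finitely many outputs of \<open>b\<close>, each cut off at a level \<open>n\<close>; the level
  belongs to the locality notion \<open>determined\<close>, so that \<open>min (b u) n\<close>
  suffices for decoding. With this decoder fixed, the truncated \<open>b\<close> is approximated by
  local rules, and for each rule the sofic limit is innermost. The decoder improves last, and the
  values of \<open>b\<close> from \<open>n\<close> on then cost one \<open>eta\<close> of a
  vanishing tail. The automorphism \<open>\<Phi>\<close> enters only through the decoder, which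
  looks up coordinate \<open>h\<close> of the second system at the translate
  \<open>inv \<Phi> h\<close>.\<close>

definition eta :: "real \<Rightarrow> real" where
  "eta t = - (t * ln t)"

definition ent :: "'a measure \<Rightarrow> ('a \<Rightarrow> 'b) \<Rightarrow> real" where
  "ent M X = (\<Sum>a\<in>X ` space M. eta (measure M {x \<in> space M. X x = a}))"

lemma eta_0 [simp]: "eta 0 = 0" and eta_1 [simp]: "eta 1 = 0"
  by (simp_all add: eta_def)

lemma eta_nonneg: "0 \<le> t \<Longrightarrow> t \<le> 1 \<Longrightarrow> 0 \<le> eta t"
  by (cases "t = 0") (auto simp: eta_def mult_nonneg_nonpos)

text \<open>The inequality \<open>ln y \<le> y - 1\<close> at \<open>y = 1 / t\<close> gives
  \<open>eta t \<le> 1 - t\<close>.\<close>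

lemma eta_le_1:
  assumes "0 \<le> t" shows "eta t \<le> 1"
proof (cases "t = 0")
  case False
  with assms have t: "t > 0" by simp
  have "t * ln (1 / t) \<le> t * (1 / t - 1)"
    using t by (intro mult_left_mono ln_le_minus_one) auto
  then show ?thesis
    using t by (simp add: eta_def ln_div algebra_simps)
qed simp

lemma eta_mult: "0 \<le> s \<Longrightarrow> 0 \<le> t \<Longrightarrow> eta (s * t) = t * eta s + s * eta t"
  by (cases "s = 0 \<or> t = 0") (auto simp: eta_def ln_mult algebra_simps)

lemma continuous_on_eta: "continuous_on {0..} eta"
proof -
  have "(eta \<longlongrightarrow> eta x) (at x within {0..})" if "x \<ge> 0" for x
  proof (cases "x = 0")
    case True
    have "((\<lambda>t. - (t * ln t)) \<longlongrightarrow> (0::real)) (at_right 0)"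
      by real_asymp
    then show ?thesis
      using True by (simp add: eta_def[abs_def] at_within_Ici_at_right)
  next
    case False
    with that have "isCont (\<lambda>t. - (t * ln t)) x"
      by (intro continuous_intros) auto
    then show ?thesis
      by (simp add: eta_def[abs_def] isCont_def filterlim_at_within_If tendsto_within_subset[of _ _ _ UNIV])
  qed
  then show ?thesis
    by (auto simp: continuous_on_def)
qed

text \<open>Each atom is at most the total \<open>s\<close>, and \<open>ln\<close> is monotone, so
  replacing \<open>ln (p a)\<close> by \<open>ln s\<close> only lowers the terms. This is why
  merging atoms lowers entropy.\<close>

lemma eta_sum_le:
  assumes "finite A" "\<And>a. a \<in> A \<Longrightarrow> 0 \<le> p a"
  shows "eta (\<Sum>a\<in>A. p a) \<le> (\<Sum>a\<in>A. eta (p a))"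
proof -
  define s where "s = (\<Sum>a\<in>A. p a)"
  have "- (p a * ln s) \<le> eta (p a)" if "a \<in> A" for a
  proof (cases "p a = 0")
    case False
    then have "0 < p a" "p a \<le> s"
      using assms that by (auto simp: s_def less_le intro!: member_le_sum)
    then show ?thesis
      by (simp add: eta_def)
  qed simp
  then have "(\<Sum>a\<in>A. - (p a * ln s)) \<le> (\<Sum>a\<in>A. eta (p a))"
    by (rule sum_mono)
  then show ?thesis
    by (simp add: eta_def s_def sum_negf sum_distrib_right)
qed

text \<open>Nonnegativity of mutual information for an unnormalised joint table \<open>p\<close> of
  total mass \<open>s\<close>. The missing normalisation allows it to be applied to one value of a
  conditioning variable at a time.\<close>

lemma eta_sum_submodular:
  fixes p :: "'a \<Rightarrow> 'b \<Rightarrow> real"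
  assumes [simp]: "finite A" "finite B" and p: "\<And>a b. 0 \<le> p a b"
  shows "(\<Sum>a\<in>A. \<Sum>b\<in>B. eta (p a b)) + eta (\<Sum>a\<in>A. \<Sum>b\<in>B. p a b)
    \<le> (\<Sum>a\<in>A. eta (\<Sum>b\<in>B. p a b)) + (\<Sum>b\<in>B. eta (\<Sum>a\<in>A. p a b))"
proof -
  define q where "q a = (\<Sum>b\<in>B. p a b)" for a
  define r where "r b = (\<Sum>a\<in>A. p a b)" for b
  define s where "s = (\<Sum>a\<in>A. \<Sum>b\<in>B. p a b)"
  have s1: "s = (\<Sum>a\<in>A. q a)" by (simp add: s_def q_def)
  have s2: "s = (\<Sum>b\<in>B. r b)" unfolding s_def r_def by (rule sum.swap)
  have q0: "q a \<ge> 0" and r0: "r b \<ge> 0" for a b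
    by (auto simp: q_def r_def intro!: sum_nonneg p)
  have s0: "s \<ge> 0" by (auto simp: s1 intro!: sum_nonneg q0)
  \<comment> \<open>The bound \<open>ln y \<le> y - 1\<close>, taken at the ratio of the product of
    the marginals to the joint mass. The left-hand sides sum to zero over the table.\<close>
  have key: "p a b - q a * r b / s \<le> p a b * (ln (p a b) + ln s - ln (q a) - ln (r b))"
    if ab: "a \<in> A" "b \<in> B" for a b
  proof (cases "p a b = 0")
    case True
    then show ?thesis using q0 r0 s0 by simp
  next
    case False
    then have P: "p a b > 0" using p[of a b] by simp
    have "p a b \<le> q a" "p a b \<le> r b" "q a \<le> s"
      using ab p q0 by (auto simp: q_def r_def s1 intro!: member_le_sum[where f="\<lambda>b. p a b"]
          member_le_sum[where f="\<lambda>a. p a b"] member_le_sum[where f="\<lambda>a. \<Sum>b\<in>B. p a b"] sum_nonneg)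
    with P have pos: "q a > 0" "r b > 0" "s > 0" by auto
    have "ln ((q a * r b) / (p a b * s)) \<le> (q a * r b) / (p a b * s) - 1"
      using P pos by (intro ln_le_minus_one) auto
    then have "p a b * ln ((q a * r b) / (p a b * s)) \<le> p a b * ((q a * r b) / (p a b * s) - 1)"
      using P by (intro mult_left_mono) auto
    also have "\<dots> = q a * r b / s - p a b"
      using P pos by (simp add: field_simps)
    also have "ln ((q a * r b) / (p a b * s)) = ln (q a) + ln (r b) - ln (p a b) - ln s"
      using P pos by (simp add: ln_div ln_mult)
    finally show ?thesis by (simp add: algebra_simps)
  qed
  have "(\<Sum>a\<in>A. \<Sum>b\<in>B. p a b - q a * r b / s) = s - (\<Sum>a\<in>A. \<Sum>b\<in>B. q a * r b) / s"
    by (simp add: sum_subtractf s_def[symmetric] sum_divide_distrib)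
  also have "(\<Sum>a\<in>A. \<Sum>b\<in>B. q a * r b) = s * s"
    by (simp add: s1[symmetric] s2[symmetric] sum_distrib_left[symmetric] sum_distrib_right[symmetric])
  \<comment> \<open>Covers \<open>s = 0\<close> as well, because division by zero yields 0.\<close>
  also have "s - s * s / s = 0" by simp
  finally have "(\<Sum>a\<in>A. \<Sum>b\<in>B. p a b - q a * r b / s) = 0" .
  moreover have "(\<Sum>a\<in>A. \<Sum>b\<in>B. p a b - q a * r b / s)
      \<le> (\<Sum>a\<in>A. \<Sum>b\<in>B. p a b * (ln (p a b) + ln s - ln (q a) - ln (r b)))"
    by (intro sum_mono key)
  ultimately have "0 \<le> (\<Sum>a\<in>A. \<Sum>b\<in>B. p a b * (ln (p a b) + ln s - ln (q a) - ln (r b)))"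
    by simp
  also have "\<dots> = - (\<Sum>a\<in>A. \<Sum>b\<in>B. eta (p a b)) + s * ln s - (\<Sum>a\<in>A. q a * ln (q a))
      - (\<Sum>a\<in>A. \<Sum>b\<in>B. p a b * ln (r b))"
    by (simp add: algebra_simps sum.distrib sum_subtractf eta_def sum_negf s_def q_def
        sum_distrib_left sum_distrib_right)
  also have "(\<Sum>a\<in>A. \<Sum>b\<in>B. p a b * ln (r b)) = (\<Sum>b\<in>B. r b * ln (r b))"
    by (subst sum.swap) (simp add: r_def sum_distrib_right)
  finally show ?thesis
    unfolding q_def[symmetric] r_def[symmetric] s1[symmetric] by (simp add: eta_def sum_negf)
qed

section \<open>Shannon inequalities and continuity for simple functions\<close>

lemma ent_eq_sum:
  assumes "finite A" "X ` space M \<subseteq> A"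
  shows "ent M X = (\<Sum>a\<in>A. eta (measure M {x \<in> space M. X x = a}))"
proof -
  have "eta (measure M {x \<in> space M. X x = a}) = 0" if "a \<in> A - X ` space M" for a
  proof -
    have "{x \<in> space M. X x = a} = {}" using that by auto
    then show ?thesis by (simp only: measure_empty eta_0)
  qed
  then show ?thesis
    unfolding ent_def using assms by (intro sum.mono_neutral_left) blast+
qed

lemma ent_eqI:
  assumes "simple_function M X" "simple_function N Y"
    and "\<And>a. measure M {x \<in> space M. X x = a} = measure N {y \<in> space N. Y y = a}"
  shows "ent M X = ent N Y"
proof -
  let ?A = "X ` space M \<union> Y ` space N"
  have "finite ?A" using assms(1,2) by (auto dest: simple_functionD(1))
  then show ?thesis
    using ent_eq_sum[of ?A X M] ent_eq_sum[of ?A Y N] assms(3) by simp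
qed

text \<open>Cruder than the logarithm of the cardinality, but enough: the bound is only ever
  multiplied by the number of bad vertices, a vanishing fraction of the model.\<close>

lemma ent_le_card:
  assumes "finite A" "X ` space M \<subseteq> A" shows "ent M X \<le> card A"
  using ent_eq_sum[OF assms] sum_mono[of A "\<lambda>a. eta (measure M {x \<in> space M. X x = a})" "\<lambda>_. 1"]
  by (simp add: eta_le_1)

lemma (in prob_space) ent_nonneg: "0 \<le> ent M X"
  by (auto simp: ent_def intro!: sum_nonneg eta_nonneg)

lemma (in prob_space) ent_const [simp]: "ent M (\<lambda>_. c) = 0"
  using ent_eq_sum[of "{c}" "\<lambda>_. c" M] by (auto simp: prob_space)

lemma simple_function_vimage_sets:
  "simple_function M X \<Longrightarrow> {x \<in> space M. X x \<in> A} \<in> sets M"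
  "simple_function M X \<Longrightarrow> {x \<in> space M. X x = a} \<in> sets M"
  using simple_functionD(2)[of M X A] simple_functionD(2)[of M X "{a}"]
  by (auto simp: vimage_def Int_def conj_commute)

lemma (in prob_space) prob_eq_sum_simple:
  assumes X: "simple_function M X" and Y: "simple_function M Y" and A: "finite A" "X ` space M \<subseteq> A"
  shows "prob {x \<in> space M. Y x = b} = (\<Sum>a\<in>A. prob {x \<in> space M. X x = a \<and> Y x = b})"
proof -
  have "{x \<in> space M. Y x = b} = (\<Union>a\<in>A. {x \<in> space M. X x = a \<and> Y x = b})"
    using A by auto
  moreover have "{x \<in> space M. X x = a \<and> Y x = b} \<in> sets M" for a
    using simple_function_vimage_sets(2)[OF simple_function_Pair[OF X Y], of "(a, b)"] by simp
  ultimately show ?thesis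
    using A finite_measure_finite_Union[of A "\<lambda>a. {x \<in> space M. X x = a \<and> Y x = b}"]
    by (auto simp: disjoint_family_on_def)
qed

text \<open>Applying \<open>f\<close> merges the atoms in each fibre, and \<open>eta_sum_le\<close>
  compares them fibre by fibre. Used in both directions, it also shows that two codings of the same
  data have equal entropy.\<close>

lemma (in prob_space) ent_compose_le:
  assumes X: "simple_function M X"
  shows "ent M (\<lambda>x. f (X x)) \<le> ent M X"
proof -
  let ?A = "X ` space M"
  let ?p = "\<lambda>a. prob {x \<in> space M. X x = a}"
  have fin: "finite ?A" using X by (rule simple_functionD)
  have Y: "simple_function M (\<lambda>x. f (X x))" using X by (rule simple_function_compose1)
  have eq: "prob {x \<in> space M. f (X x) = b} = (\<Sum>a\<in>{a\<in>?A. f a = b}. ?p a)" for b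
  proof -
    have "prob {x \<in> space M. f (X x) = b} = (\<Sum>a\<in>?A. prob {x \<in> space M. X x = a \<and> f (X x) = b})"
      by (rule prob_eq_sum_simple[OF X Y fin]) simp
    also have "\<dots> = (\<Sum>a\<in>?A. if f a = b then ?p a else 0)"
      by (intro sum.cong refl) (auto cong: conj_cong intro: arg_cong[where f=prob])
    finally show ?thesis using fin by (simp add: sum.inter_filter)
  qed
  have "ent M (\<lambda>x. f (X x)) = (\<Sum>b\<in>f ` ?A. eta (\<Sum>a\<in>{a\<in>?A. f a = b}. ?p a))"
    by (simp add: ent_def eq image_image)
  also have "\<dots> \<le> (\<Sum>b\<in>f ` ?A. \<Sum>a\<in>{a\<in>?A. f a = b}. eta (?p a))"
    using fin by (intro sum_mono eta_sum_le) auto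
  also have "\<dots> = ent M X"
    unfolding ent_def using fin by (intro sum.group) auto
  finally show ?thesis .
qed

text \<open>Conditional subadditivity H(X,Y|Z) \<le> H(X|Z) + H(Y|Z), with the conditional entropies
  cleared into joint ones. The table inequality is summed over the values of
  \<open>Z\<close>.\<close>

lemma (in prob_space) ent_submodular:
  assumes X: "simple_function M X" and Y: "simple_function M Y" and Z: "simple_function M Z"
  shows "ent M (\<lambda>x. (X x, Y x, Z x)) + ent M Z \<le> ent M (\<lambda>x. (X x, Z x)) + ent M (\<lambda>x. (Y x, Z x))"
proof -
  define A B C where "A = X ` space M" "B = Y ` space M" "C = Z ` space M"
  have fin [simp]: "finite A" "finite B" "finite C"
    using X Y Z by (auto simp: A_B_C_def dest: simple_functionD)
  define p where "p a b c = prob {x \<in> space M. X x = a \<and> Y x = b \<and> Z x = c}" for a b c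
  have XZ: "prob {x \<in> space M. X x = a \<and> Z x = c} = (\<Sum>b\<in>B. p a b c)" for a c
    using prob_eq_sum_simple[OF Y simple_function_Pair[OF X Z] fin(2), of "(a, c)"]
    by (auto simp: A_B_C_def p_def conj_ac)
  have YZ: "prob {x \<in> space M. Y x = b \<and> Z x = c} = (\<Sum>a\<in>A. p a b c)" for b c
    using prob_eq_sum_simple[OF X simple_function_Pair[OF Y Z] fin(1), of "(b, c)"]
    by (auto simp: A_B_C_def p_def conj_ac)
  have Zp: "prob {x \<in> space M. Z x = c} = (\<Sum>a\<in>A. \<Sum>b\<in>B. p a b c)" for c
    using prob_eq_sum_simple[OF X Z fin(1), of c] by (simp add: XZ A_B_C_def)
  have 1: "ent M (\<lambda>x. (X x, Y x, Z x)) = (\<Sum>c\<in>C. \<Sum>a\<in>A. \<Sum>b\<in>B. eta (p a b c))"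
  proof -
    have "ent M (\<lambda>x. (X x, Y x, Z x)) = (\<Sum>(a, b, c)\<in>A \<times> B \<times> C. eta (p a b c))"
      by (subst ent_eq_sum[of "A \<times> B \<times> C"]) (auto simp: p_def intro!: sum.cong, auto simp: A_B_C_def)
    also have "\<dots> = (\<Sum>a\<in>A. \<Sum>b\<in>B. \<Sum>c\<in>C. eta (p a b c))"
      by (simp add: sum.cartesian_product)
    also have "\<dots> = (\<Sum>a\<in>A. \<Sum>c\<in>C. \<Sum>b\<in>B. eta (p a b c))"
      by (intro sum.cong refl sum.swap)
    also have "\<dots> = (\<Sum>c\<in>C. \<Sum>a\<in>A. \<Sum>b\<in>B. eta (p a b c))"
      by (rule sum.swap)
    finally show ?thesis .
  qed
  have 2: "ent M (\<lambda>x. (X x, Z x)) = (\<Sum>c\<in>C. \<Sum>a\<in>A. eta (\<Sum>b\<in>B. p a b c))"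
  proof -
    have "ent M (\<lambda>x. (X x, Z x)) = (\<Sum>(a, c)\<in>A \<times> C. eta (\<Sum>b\<in>B. p a b c))"
      by (subst ent_eq_sum[of "A \<times> C"]) (auto simp: XZ intro!: sum.cong, auto simp: A_B_C_def)
    also have "\<dots> = (\<Sum>a\<in>A. \<Sum>c\<in>C. eta (\<Sum>b\<in>B. p a b c))"
      by (simp add: sum.cartesian_product)
    also have "\<dots> = (\<Sum>c\<in>C. \<Sum>a\<in>A. eta (\<Sum>b\<in>B. p a b c))"
      by (rule sum.swap)
    finally show ?thesis .
  qed
  have 3: "ent M (\<lambda>x. (Y x, Z x)) = (\<Sum>c\<in>C. \<Sum>b\<in>B. eta (\<Sum>a\<in>A. p a b c))"
  proof -
    have "ent M (\<lambda>x. (Y x, Z x)) = (\<Sum>(b, c)\<in>B \<times> C. eta (\<Sum>a\<in>A. p a b c))"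
      by (subst ent_eq_sum[of "B \<times> C"]) (auto simp: YZ intro!: sum.cong, auto simp: A_B_C_def)
    also have "\<dots> = (\<Sum>b\<in>B. \<Sum>c\<in>C. eta (\<Sum>a\<in>A. p a b c))"
      by (simp add: sum.cartesian_product)
    also have "\<dots> = (\<Sum>c\<in>C. \<Sum>b\<in>B. eta (\<Sum>a\<in>A. p a b c))"
      by (rule sum.swap)
    finally show ?thesis .
  qed
  have 4: "ent M Z = (\<Sum>c\<in>C. eta (\<Sum>a\<in>A. \<Sum>b\<in>B. p a b c))"
    by (simp add: ent_def A_B_C_def(3) Zp)
  show ?thesis
    unfolding 1 2 3 4 sum.distrib[symmetric]
    by (intro sum_mono eta_sum_submodular) (auto simp: p_def)
qed

text \<open>Conditioning on less information raises conditional entropy: submodularity with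
  \<open>f (Y x)\<close> as the common variable, which adds nothing to \<open>Y\<close>. This is
  what allows knowledge of a whole labelling to be replaced by the pattern near one vertex.\<close>

lemma (in prob_space) ent_cond_compose_le:
  assumes X: "simple_function M X" and Y: "simple_function M Y"
  shows "ent M (\<lambda>x. (X x, Y x)) - ent M Y \<le> ent M (\<lambda>x. (X x, f (Y x))) - ent M (\<lambda>x. f (Y x))"
proof -
  have "ent M (\<lambda>x. (X x, Y x, f (Y x))) + ent M (\<lambda>x. f (Y x))
      \<le> ent M (\<lambda>x. (X x, f (Y x))) + ent M (\<lambda>x. (Y x, f (Y x)))"
    by (rule ent_submodular[OF X Y simple_function_compose1[OF Y]])
  moreover have "ent M (\<lambda>x. (Y x, f (Y x))) \<le> ent M Y"
    using ent_compose_le[OF Y, of "\<lambda>y. (y, f y)"] by simp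
  moreover have "ent M (\<lambda>x. (X x, Y x)) \<le> ent M (\<lambda>x. (X x, Y x, f (Y x)))"
    using ent_compose_le[OF simple_function_Pair[OF X simple_function_Pair[OF Y simple_function_compose1[OF Y]]],
        of "\<lambda>(x, y, z). (x, y)" f] by simp
  ultimately show ?thesis by linarith
qed

lemma (in prob_space) ent_pair_le:
  assumes "simple_function M X" and "simple_function M Y"
  shows "ent M (\<lambda>x. (X x, Y x)) \<le> ent M X + ent M Y"
proof -
  have "ent M (\<lambda>x. (X x, Y x)) - ent M Y \<le> ent M (\<lambda>x. (X x, ()))"
    using ent_cond_compose_le[OF assms, of "\<lambda>_. ()"] by simp
  also have "\<dots> \<le> ent M X"
    using ent_compose_le[OF assms(1), of "\<lambda>x. (x, ())"] .
  finally show ?thesis by simp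
qed

text \<open>The product rule \<open>eta_mult\<close> splits every joint atom, and the other marginal
  sums to one.\<close>

lemma (in prob_space) ent_pair_indep:
  assumes X: "simple_function M X" and Y: "simple_function M Y"
    and ind: "\<And>a b. prob {x \<in> space M. X x = a \<and> Y x = b}
      = prob {x \<in> space M. X x = a} * prob {x \<in> space M. Y x = b}"
  shows "ent M (\<lambda>x. (X x, Y x)) = ent M X + ent M Y"
proof -
  define A B where "A = X ` space M" "B = Y ` space M"
  have fin [simp]: "finite A" "finite B"
    using X Y by (auto simp: A_B_def dest: simple_functionD)
  define p where "p a = prob {x \<in> space M. X x = a}" for a
  define q where "q b = prob {x \<in> space M. Y x = b}" for b
  have "(\<Sum>a\<in>A. p a) = 1"
    using prob_eq_sum_simple[OF X simple_function_const[of M "()"] fin(1), of "()"]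
    by (simp add: A_B_def p_def prob_space)
  moreover have "(\<Sum>b\<in>B. q b) = 1"
    using prob_eq_sum_simple[OF Y simple_function_const[of M "()"] fin(2), of "()"]
    by (simp add: A_B_def q_def prob_space)
  moreover have "ent M (\<lambda>x. (X x, Y x)) = (\<Sum>(a, b)\<in>A \<times> B. eta (p a * q b))"
    by (subst ent_eq_sum[of "A \<times> B"]) (auto simp: ind p_def q_def intro!: sum.cong, auto simp: A_B_def)
  then have "ent M (\<lambda>x. (X x, Y x)) = (\<Sum>a\<in>A. \<Sum>b\<in>B. q b * eta (p a) + p a * eta (q b))"
    by (simp add: sum.cartesian_product eta_mult p_def q_def)
  ultimately have "ent M (\<lambda>x. (X x, Y x)) = (\<Sum>a\<in>A. eta (p a)) + (\<Sum>b\<in>B. eta (q b))"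
    by (simp add: sum.distrib sum_distrib_left[symmetric] sum_distrib_right[symmetric])
  then show ?thesis
    by (simp add: ent_def A_B_def p_def q_def)
qed

lemma simple_function_restrict:
  assumes "finite V" "\<And>v. v \<in> V \<Longrightarrow> simple_function M (X v)"
  shows "simple_function M (\<lambda>x. \<lambda>v\<in>V. X v x)"
  using assms
proof (induction V rule: finite_induct)
  case empty
  then show ?case by (simp add: restrict_def)
next
  case (insert u V)
  have "simple_function M (\<lambda>x. (\<lambda>v\<in>V. X v x)(u := X u x))"
    using insert.IH insert.prems by (intro simple_function_compose2[where h = "\<lambda>f y. f(u := y)"]) blast+
  moreover have "(\<lambda>v\<in>insert u V. X v x) = (\<lambda>v\<in>V. X v x)(u := X u x)" for x
    by (auto simp: restrict_def)
  ultimately show ?case by (simp only:)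
qed

text \<open>Each side is a function of the other: a function update one way, evaluation at
  \<open>u\<close> and restriction to \<open>V\<close> the other way.\<close>

lemma (in prob_space) ent_restrict_insert:
  assumes "finite V" "u \<notin> V" "\<And>v. v \<in> insert u V \<Longrightarrow> simple_function M (X v)" "simple_function M Y"
  shows "ent M (\<lambda>x. (\<lambda>v\<in>insert u V. X v x, Y x)) = ent M (\<lambda>x. (X u x, \<lambda>v\<in>V. X v x, Y x))"
proof (rule antisym)
  have s1: "simple_function M (\<lambda>x. (X u x, \<lambda>v\<in>V. X v x, Y x))"
    and s2: "simple_function M (\<lambda>x. (\<lambda>v\<in>insert u V. X v x, Y x))"
    using assms by (auto intro!: simple_function_Pair simple_function_restrict)
  have 1: "(\<lambda>v\<in>insert u V. X v x) = (\<lambda>v\<in>V. X v x)(u := X u x)" for x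
    by (auto simp: restrict_def)
  show "ent M (\<lambda>x. (\<lambda>v\<in>insert u V. X v x, Y x)) \<le> ent M (\<lambda>x. (X u x, \<lambda>v\<in>V. X v x, Y x))"
    using ent_compose_le[OF s1, of "\<lambda>(a, f, y). (f(u := a), y)"] by (simp add: 1)
  have "restrict (\<lambda>v\<in>insert u V. X v x) V = (\<lambda>v\<in>V. X v x)" for x
    by (auto simp: restrict_def)
  then show "ent M (\<lambda>x. (X u x, \<lambda>v\<in>V. X v x, Y x)) \<le> ent M (\<lambda>x. (\<lambda>v\<in>insert u V. X v x, Y x))"
    using ent_compose_le[OF s2, of "\<lambda>(f, y). (f u, restrict f V, y)"] by simp
qed

text \<open>Subadditivity of conditional entropy over a finite family. Every induction step is one
  use of \<open>ent_submodular\<close> with \<open>Y\<close> as the conditioning variable.\<close>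

lemma (in prob_space) ent_restrict_cond_le:
  assumes "finite V" "\<And>v. v \<in> V \<Longrightarrow> simple_function M (X v)" and Y: "simple_function M Y"
  shows "ent M (\<lambda>x. (\<lambda>v\<in>V. X v x, Y x)) \<le> ent M Y + (\<Sum>v\<in>V. ent M (\<lambda>x. (X v x, Y x)) - ent M Y)"
  using assms(1,2)
proof (induction V rule: finite_induct)
  case empty
  then show ?case using ent_compose_le[OF Y, of "\<lambda>y. (\<lambda>v. undefined, y)"] by (simp add: restrict_def)
next
  case (insert u V)
  have "ent M (\<lambda>x. (X u x, \<lambda>v\<in>V. X v x, Y x)) + ent M Y
      \<le> ent M (\<lambda>x. (X u x, Y x)) + ent M (\<lambda>x. (\<lambda>v\<in>V. X v x, Y x))"
    using insert Y by (intro ent_submodular simple_function_restrict) auto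
  moreover have "ent M (\<lambda>x. (\<lambda>v\<in>V. X v x, Y x)) \<le> ent M Y + (\<Sum>v\<in>V. ent M (\<lambda>x. (X v x, Y x)) - ent M Y)"
    using insert.IH insert.prems by blast
  ultimately show ?case
    using ent_restrict_insert[OF insert.hyps(1,2) insert.prems Y]
    by (simp only: sum.insert[OF insert.hyps(1,2)])
qed

lemma (in prob_space) ent_restrict_le:
  assumes "finite V" "\<And>v. v \<in> V \<Longrightarrow> simple_function M (X v)"
  shows "ent M (\<lambda>x. \<lambda>v\<in>V. X v x) \<le> (\<Sum>v\<in>V. ent M (X v))"
proof -
  have "ent M (\<lambda>x. \<lambda>v\<in>V. X v x) \<le> ent M (\<lambda>x. (\<lambda>v\<in>V. X v x, ()))"
    using ent_compose_le[of "\<lambda>x. (\<lambda>v\<in>V. X v x, ())" fst] simple_function_restrict[OF assms]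
    by simp
  also have "\<dots> \<le> (\<Sum>v\<in>V. ent M (\<lambda>x. (X v x, ())))"
    using ent_restrict_cond_le[OF assms, where Y = "\<lambda>_. ()"] by simp
  also have "\<dots> \<le> (\<Sum>v\<in>V. ent M (X v))"
    using assms ent_compose_le[of _ "\<lambda>x. (x, ())"] by (intro sum_mono) auto
  finally show ?thesis .
qed

text \<open>Every atom moves by at most the probability of disagreement. Since one finite alphabet
  \<open>A\<close> serves all \<open>l\<close>, continuity of \<open>eta\<close> passes through the
  finite sum.\<close>

lemma (in prob_space) ent_tendsto:
  assumes A: "finite A" "X ` space M \<subseteq> A" "\<And>l. Y l ` space M \<subseteq> A"
    and X: "simple_function M X" and Y: "\<And>l. simple_function M (Y l)"
    and lim: "(\<lambda>l. prob {x \<in> space M. Y l x \<noteq> X x}) \<longlonglongrightarrow> 0"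
  shows "(\<lambda>l. ent M (Y l)) \<longlonglongrightarrow> ent M X"
proof -
  have meas: "{x \<in> space M. Y l x \<noteq> X x} \<in> sets M" for l
    using simple_function_vimage_sets(1)[OF simple_function_Pair[OF Y X], of l "{(a, b). a \<noteq> b}"] by simp
  have "(\<lambda>l. prob {x \<in> space M. Y l x = a}) \<longlonglongrightarrow> prob {x \<in> space M. X x = a}" for a
  proof (rule Lim_transform2[OF tendsto_const])
    have "norm (prob {x \<in> space M. X x = a} - prob {x \<in> space M. Y l x = a})
        \<le> prob {x \<in> space M. Y l x \<noteq> X x}" for l
    proof -
      have "prob {x \<in> space M. X x = a}
          \<le> prob ({x \<in> space M. Y l x = a} \<union> {x \<in> space M. Y l x \<noteq> X x})"
        using X Y meas by (intro finite_measure_mono sets.Un simple_function_vimage_sets) auto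
      moreover have "prob {x \<in> space M. Y l x = a}
          \<le> prob ({x \<in> space M. X x = a} \<union> {x \<in> space M. Y l x \<noteq> X x})"
        using X Y meas by (intro finite_measure_mono sets.Un simple_function_vimage_sets) auto
      moreover have "prob (S \<union> {x \<in> space M. Y l x \<noteq> X x}) \<le> prob S + prob {x \<in> space M. Y l x \<noteq> X x}"
        if "S \<in> sets M" for S
        using meas that by (intro measure_Un_le)
      ultimately show ?thesis
        using simple_function_vimage_sets(2)[OF X, of a] simple_function_vimage_sets(2)[OF Y, of l a]
        by (smt (verit, best) real_norm_def)
    qed
    then show "(\<lambda>l. prob {x \<in> space M. X x = a} - prob {x \<in> space M. Y l x = a}) \<longlonglongrightarrow> 0"
      by (intro Lim_null_comparison[OF _ lim] always_eventually allI)
  qed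
  then have "(\<lambda>l. eta (prob {x \<in> space M. Y l x = a})) \<longlonglongrightarrow> eta (prob {x \<in> space M. X x = a})" for a
    by (intro continuous_on_tendsto_compose[OF continuous_on_eta]) auto
  then show ?thesis
    using A by (simp add: ent_eq_sum tendsto_sum)
qed

section \<open>The entropy inequality on sofic models\<close>

lemma space_PiM_UNIV: "space \<kappa> = UNIV \<Longrightarrow> space (PiM UNIV (\<lambda>_. \<kappa>)) = UNIV"
  by (simp add: space_PiM)

lemma measurable_PiM_reindex:
  "(\<lambda>x h. x (\<rho> h)) \<in> measurable (PiM UNIV (\<lambda>_. \<kappa>)) (PiM UNIV (\<lambda>_. \<kappa>))"
  by (intro measurable_PiM_single') (auto simp: space_PiM)

text \<open>The event reads only the coordinates in \<open>H\<close>, where \<open>\<rho>\<close> is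
  injective, so it reads distinct independent labels on either side. Outside \<open>H\<close> the
  map may collapse points, as it must when an infinite group is mapped into a finite model.\<close>

lemma measure_PiM_reindex:
  fixes \<kappa> :: "'k measure" and \<rho> :: "'g \<Rightarrow> 'v" and A :: "('g \<Rightarrow> 'k) set"
  assumes \<kappa>: "prob_space \<kappa>" "space \<kappa> = UNIV" and A: "A \<in> sets (PiM UNIV (\<lambda>_. \<kappa>))"
    and loc: "\<And>x y. (\<And>h. h \<in> H \<Longrightarrow> x h = y h) \<Longrightarrow> x \<in> A \<longleftrightarrow> y \<in> A"
    and inj: "inj_on \<rho> H"
  shows "measure (PiM UNIV (\<lambda>_. \<kappa>)) {x. (\<lambda>h. x (\<rho> h)) \<in> A} = measure (PiM UNIV (\<lambda>_. \<kappa>)) A"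
proof -
  let ?R = "PiM H (\<lambda>_. \<kappa>)"
  \<comment> \<open>The filler outside \<open>H\<close> is arbitrary; by \<open>loc\<close> it
    cannot affect membership in \<open>A\<close>.\<close>
  define ext where "ext z = (\<lambda>h. if h \<in> H then z h else undefined)" for z :: "'g \<Rightarrow> 'k"
  have ext: "ext \<in> measurable ?R (PiM UNIV (\<lambda>_. \<kappa>))"
  proof -
    have "(\<lambda>z. if h \<in> H then z h else undefined) \<in> measurable ?R \<kappa>" for h
      by (cases "h \<in> H") (auto simp: \<kappa>)
    then show ?thesis
      unfolding ext_def by (intro measurable_PiM_single') (auto simp: \<kappa> space_PiM)
  qed
  define A' where "A' = ext -` A \<inter> space ?R"
  have A': "A' \<in> sets ?R"
    unfolding A'_def using ext A by (rule measurable_sets)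
  \<comment> \<open>Stated for an arbitrary target type, so that it applies both to
    \<open>\<rho>\<close> and to the identity; both reduce to the same event \<open>A'\<close> over
    \<open>H\<close>.\<close>
  have *: "measure (PiM UNIV (\<lambda>_. \<kappa>)) {x. (\<lambda>h. x (r h)) \<in> A} = measure ?R A'"
    if "inj_on r H" for r :: "'g \<Rightarrow> 'w"
  proof -
    let ?t = "\<lambda>x. \<lambda>n\<in>H. x (r n)"
    have t: "?t \<in> measurable (PiM UNIV (\<lambda>_. \<kappa>)) ?R"
      by (intro measurable_restrict measurable_component_singleton) auto
    have "measure ?R A' = measure (distr (PiM UNIV (\<lambda>_. \<kappa>)) ?R ?t) A'"
      using distr_PiM_reindex[of UNIV "\<lambda>_. \<kappa>" r H] \<kappa>(1) that by simp
    also have "\<dots> = measure (PiM UNIV (\<lambda>_. \<kappa>)) (?t -` A' \<inter> space (PiM UNIV (\<lambda>_. \<kappa>)))"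
      using t A' by (rule measure_distr)
    also have "?t -` A' \<inter> space (PiM UNIV (\<lambda>_. \<kappa>)) = {x. (\<lambda>h. x (r h)) \<in> A}"
    proof -
      have "ext (?t x) \<in> A \<longleftrightarrow> (\<lambda>h. x (r h)) \<in> A" for x
        by (rule loc) (simp add: ext_def)
      then show ?thesis
        by (auto simp: A'_def \<kappa> space_PiM_UNIV space_PiM)
    qed
    finally show ?thesis by simp
  qed
  show ?thesis
    using *[OF inj] *[of "\<lambda>h. h"] by simp
qed

lemma ent_PiM_reindex:
  fixes \<kappa> :: "'k measure" and \<rho> :: "'g \<Rightarrow> 'v"
  assumes \<kappa>: "prob_space \<kappa>" "space \<kappa> = UNIV" and X: "simple_function (PiM UNIV (\<lambda>_. \<kappa>)) X"
    and loc: "\<And>x y. (\<And>h. h \<in> H \<Longrightarrow> x h = y h) \<Longrightarrow> X x = X y"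
    and inj: "inj_on \<rho> H"
  shows "ent (PiM UNIV (\<lambda>_. \<kappa>)) (\<lambda>x. X (\<lambda>h. x (\<rho> h))) = ent (PiM UNIV (\<lambda>_. \<kappa>)) X"
proof -
  let ?X = "\<lambda>x. X (\<lambda>h. x (\<rho> h))"
  have X': "simple_function (PiM UNIV (\<lambda>_. \<kappa>)) ?X"
    by (rule simple_function_comp[OF measurable_PiM_reindex[of \<rho>] X])
  have "measure (PiM UNIV (\<lambda>_. \<kappa>)) {x. ?X x = a} = measure (PiM UNIV (\<lambda>_. \<kappa>)) {y. X y = a}" for a
  proof -
    have meas: "{y. X y = a} \<in> sets (PiM UNIV (\<lambda>_. \<kappa>))"
      using simple_function_vimage_sets(2)[OF X, of a] by (simp add: \<kappa> space_PiM_UNIV)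
    have loc': "x \<in> {y. X y = a} \<longleftrightarrow> y \<in> {y. X y = a}" if "\<And>h. h \<in> H \<Longrightarrow> x h = y h" for x y
      using loc[of x y] that by simp
    show ?thesis
      using measure_PiM_reindex[OF \<kappa> meas loc' inj] by simp
  qed
  then show ?thesis
    by (intro ent_eqI[OF X' X]) (simp add: \<kappa> space_PiM_UNIV)
qed

section \<open>Entropy of independent labels\<close>

lemma measure_PiM_cylinder:
  assumes \<kappa>: "prob_space \<kappa>" "space \<kappa> = UNIV" and J: "finite J" "\<And>v. v \<in> J \<Longrightarrow> A v \<in> sets \<kappa>"
  shows "measure (PiM UNIV (\<lambda>_. \<kappa>)) {x. \<forall>v\<in>J. x v \<in> A v} = (\<Prod>v\<in>J. measure \<kappa> (A v))"
proof -
  interpret product_prob_space "\<lambda>_. \<kappa>" UNIV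
    using \<kappa> by (intro product_prob_spaceI)
  have "prod_emb UNIV (\<lambda>_. \<kappa>) J (Pi\<^sub>E J A) = {x. \<forall>v\<in>J. x v \<in> A v}"
    by (auto simp: prod_emb_def \<kappa> space_PiM)
  then show ?thesis
    using measure_PiM_emb[of J A] J by simp
qed

lemma ent_PiM_coordinate:
  assumes \<kappa>: "prob_space \<kappa>" "space \<kappa> = UNIV" and P: "simple_function \<kappa> P"
  shows "ent (PiM UNIV (\<lambda>_. \<kappa>)) (\<lambda>x. P (x v)) = ent \<kappa> P"
proof (rule ent_eqI[OF _ P])
  show "simple_function (PiM UNIV (\<lambda>_. \<kappa>)) (\<lambda>x. P (x v))"
    by (rule simple_function_comp[OF _ P]) simp
  show "measure (PiM UNIV (\<lambda>_. \<kappa>)) {x \<in> space (PiM UNIV (\<lambda>_. \<kappa>)). P (x v) = a}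
      = measure \<kappa> {y \<in> space \<kappa>. P y = a}" for a
    using measure_PiM_cylinder[OF \<kappa>, of "{v}" "\<lambda>_. {y. P y = a}"] simple_function_vimage_sets(2)[OF P, of a]
    by (simp add: \<kappa> space_PiM_UNIV)
qed

text \<open>The label at a new vertex is independent of those already collected, so each vertex adds
  one copy of \<open>ent \<kappa> P\<close>.\<close>

lemma ent_PiM_restrict:
  fixes \<kappa> :: "'k measure" and V :: "'v set"
  assumes \<kappa>: "prob_space \<kappa>" "space \<kappa> = UNIV" and P: "simple_function \<kappa> P" and V: "finite V"
  shows "ent (PiM UNIV (\<lambda>_. \<kappa>)) (\<lambda>x. \<lambda>v\<in>V. P (x v)) = card V * ent \<kappa> P"
  using V
proof (induction V rule: finite_induct)
  let ?N = "PiM UNIV (\<lambda>_::'v. \<kappa>)"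
  interpret N: prob_space ?N
    using \<kappa> by (intro prob_space_PiM)
  case empty
  then show ?case by (simp add: restrict_def)
next
  let ?N = "PiM UNIV (\<lambda>_::'v. \<kappa>)"
  interpret N: prob_space ?N
    using \<kappa> by (intro prob_space_PiM)
  case (insert u V)
  have sp: "space ?N = UNIV" by (rule space_PiM_UNIV[OF \<kappa>(2)])
  have Pv: "simple_function ?N (\<lambda>x. P (x v))" for v
    by (rule simple_function_comp[OF _ P]) simp
  have PV: "simple_function ?N (\<lambda>x. \<lambda>v\<in>W. P (x v))" if "finite W" for W
    using that Pv by (rule simple_function_restrict)
  have Pm: "{k. P k = a} \<in> sets \<kappa>" for a
    using simple_function_vimage_sets(2)[OF P, of a] by (simp add: \<kappa>)
  have cyl: "N.prob {x. \<forall>v\<in>J. P (x v) = a v} = (\<Prod>v\<in>J. measure \<kappa> {k. P k = a v})"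
    if "finite J" for J a
    using measure_PiM_cylinder[OF \<kappa> that, of "\<lambda>v. {k. P k = a v}"] Pm by simp
  have ind: "N.prob {x. P (x u) = a \<and> (\<lambda>v\<in>V. P (x v)) = b}
      = N.prob {x. P (x u) = a} * N.prob {x. (\<lambda>v\<in>V. P (x v)) = b}" for a b
  \<comment> \<open>A value \<open>b\<close> that is not \<open>undefined\<close> off
    \<open>V\<close> is never attained, and both sides vanish; otherwise the event is a
    cylinder.\<close>
  proof (cases "b \<in> extensional V")
    case True
    then have eq: "(\<lambda>v\<in>V. P (x v)) = b \<longleftrightarrow> (\<forall>v\<in>V. P (x v) = b v)" for x
      by (auto simp: fun_eq_iff extensional_def restrict_def)
    have "N.prob {x. P (x u) = a \<and> (\<forall>v\<in>V. P (x v) = b v)}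
        = N.prob {x. \<forall>v\<in>insert u V. P (x v) = (b(u := a)) v}"
      using insert.hyps by (intro arg_cong[where f = N.prob]) auto
    also have "\<dots> = measure \<kappa> {k. P k = a} * (\<Prod>v\<in>V. measure \<kappa> {k. P k = (b(u := a)) v})"
      using insert.hyps by (subst cyl) auto
    also have "(\<Prod>v\<in>V. measure \<kappa> {k. P k = (b(u := a)) v}) = (\<Prod>v\<in>V. measure \<kappa> {k. P k = b v})"
      using insert.hyps by (intro prod.cong) auto
    finally show ?thesis
      using cyl[of "{u}" "\<lambda>_. a"] cyl[of V b] insert.hyps by (simp add: eq)
  next
    case False
    then have "{x. (\<lambda>v\<in>V. P (x v)) = b} = {}" by auto
    then show ?thesis by auto
  qed
  have "ent ?N (\<lambda>x. \<lambda>v\<in>insert u V. P (x v)) = ent ?N (\<lambda>x. (P (x u), \<lambda>v\<in>V. P (x v)))"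
  proof (rule antisym)
    have 1: "(\<lambda>v\<in>insert u V. P (x v)) = (\<lambda>v\<in>V. P (x v))(u := P (x u))" for x
      by (auto simp: restrict_def)
    have 2: "restrict (\<lambda>v\<in>insert u V. P (x v)) V = (\<lambda>v\<in>V. P (x v))" for x
      by (auto simp: restrict_def)
    show "ent ?N (\<lambda>x. \<lambda>v\<in>insert u V. P (x v)) \<le> ent ?N (\<lambda>x. (P (x u), \<lambda>v\<in>V. P (x v)))"
      using N.ent_compose_le[OF simple_function_Pair[OF Pv PV[OF insert.hyps(1)]], of "\<lambda>(a, f). f(u := a)" u]
      by (simp add: 1)
    show "ent ?N (\<lambda>x. (P (x u), \<lambda>v\<in>V. P (x v))) \<le> ent ?N (\<lambda>x. \<lambda>v\<in>insert u V. P (x v))"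
      using N.ent_compose_le[OF PV[of "insert u V"], of "\<lambda>f. (f u, restrict f V)"] insert.hyps(1)
      by (simp add: 2 del: restrict_restrict)
  qed
  also have "\<dots> = ent ?N (\<lambda>x. P (x u)) + ent ?N (\<lambda>x. \<lambda>v\<in>V. P (x v))"
    using ind by (intro N.ent_pair_indep Pv PV insert.hyps) (simp add: sp)
  finally show ?case
    using insert.hyps
    by (simp add: ent_PiM_coordinate[OF \<kappa> P] insert.IH algebra_simps del: restrict_apply)
qed

text \<open>\<open>D\<close> is the set of coordinates read by the rule \<open>B\<close>,
  \<open>E\<close> the set of positions at which outputs of \<open>B\<close> are available for
  decoding, and \<open>P\<close> a finite partition of the alphabet whose class is to be
  recovered.\<close>

locale local_observable =
  fixes \<kappa> :: "'k measure" and B :: "('g::group_add \<Rightarrow> 'k) \<Rightarrow> 'b" and P :: "'k \<Rightarrow> 'c" and D E :: "'g set"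
  assumes prob: "prob_space \<kappa>" and space: "space \<kappa> = UNIV"
    and B: "simple_function (PiM UNIV (\<lambda>_. \<kappa>)) B"
    and P: "simple_function \<kappa> P"
    and fin: "finite D" "finite E"
    and loc: "\<And>x y. (\<And>h. h \<in> D \<Longrightarrow> x h = y h) \<Longrightarrow> B x = B y"
begin

definition pattern :: "('g \<Rightarrow> 'k) \<Rightarrow> 'g \<Rightarrow> 'b" where
  "pattern x = (\<lambda>g\<in>E. B (\<lambda>f. x (g + f)))"

text \<open>Every coordinate read by \<open>P (x 0)\<close>, by \<open>B\<close>, or by
  \<open>pattern\<close>. If these name distinct vertices around a vertex of a model, the labels
  seen there have the same joint law as in the group.\<close>

definition window :: "'g set" where
  "window = insert 0 (D \<union> (\<Union>g\<in>E. (+) g ` D))"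

abbreviation \<mu> :: "('g \<Rightarrow> 'k) measure" where
  "\<mu> \<equiv> PiM UNIV (\<lambda>_. \<kappa>)"

text \<open>The cost of one good vertex: the entropy of its output plus the conditional entropy of
  its label class given the nearby outputs.\<close>

definition rate :: real where
  "rate = ent \<mu> B + (ent \<mu> (\<lambda>x. (P (x 0), pattern x)) - ent \<mu> pattern)"

lemma simple_pattern: "simple_function \<mu> pattern"
  unfolding pattern_def
  by (intro simple_function_restrict fin simple_function_comp[OF measurable_PiM_reindex B])

lemma simple_coordinate: "simple_function (PiM UNIV (\<lambda>_. \<kappa>)) (\<lambda>x. P (x v))"
  by (rule simple_function_comp[OF _ P]) simp

lemma rate_nonneg: "0 \<le> rate"
proof -
  interpret prob_space \<mu> using prob by (intro prob_space_PiM)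
  have "ent \<mu> pattern \<le> ent \<mu> (\<lambda>x. (P (x 0), pattern x))"
    using ent_compose_le[OF simple_function_Pair[OF simple_coordinate simple_pattern], of snd] by simp
  then show ?thesis
    using ent_nonneg[of B] by (simp add: rate_def)
qed

lemma pattern_local:
  assumes "\<And>h. h \<in> window \<Longrightarrow> x h = y h" shows "pattern x = pattern y"
  unfolding pattern_def using assms by (intro restrict_ext loc) (auto simp: window_def)

text \<open>Here \<open>\<rho> h v\<close> is the vertex at position \<open>h\<close> as seen from
  \<open>v\<close>, and \<open>W\<close> consists of vertices whose surroundings imitate the group.
  The total entropy of the labels is distributed over the vertices; good ones pay at most
  \<open>rate\<close>, the others a crude constant.\<close>

lemma model_inequality:
  fixes \<rho> :: "'g \<Rightarrow> 'v \<Rightarrow> 'v"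
  assumes V: "finite V" "\<And>h v. v \<in> V \<Longrightarrow> \<rho> h v \<in> V" and W: "W \<subseteq> V"
    and good: "\<And>v. v \<in> W \<Longrightarrow> \<rho> 0 v = v" "\<And>v. v \<in> W \<Longrightarrow> inj_on (\<lambda>h. \<rho> h v) window"
      "\<And>v f g. v \<in> W \<Longrightarrow> f \<in> D \<Longrightarrow> g \<in> E \<Longrightarrow> \<rho> f (\<rho> g v) = \<rho> (g + f) v"
  shows "card V * ent \<mu> (\<lambda>x. P (x 0))
    \<le> card W * rate + card (V - W) * (real (card (range B)) + real (card (range P)))"
proof -
  let ?N = "PiM UNIV (\<lambda>_::'v. \<kappa>)"
  interpret N: prob_space ?N using prob by (intro prob_space_PiM)
  have sp: "space ?N = UNIV" "space \<mu> = UNIV" by (auto intro!: space_PiM_UNIV space)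
  define y where "y v x = B (\<lambda>h. x (\<rho> h v))" for v x
  define Y where "Y x = (\<lambda>v\<in>V. y v x)" for x
  define T where "T v = ent ?N (y v) + (ent ?N (\<lambda>x. (P (x v), Y x)) - ent ?N Y)" for v
  have y: "simple_function ?N (y v)" for v
    unfolding y_def by (intro simple_function_comp[OF measurable_PiM_reindex B])
  have Y: "simple_function ?N Y"
    unfolding Y_def by (intro simple_function_restrict V y)
  have PV: "simple_function ?N (\<lambda>x. \<lambda>v\<in>V. P (x v))"
    using V(1) simple_coordinate by (rule simple_function_restrict)
  have Tgood: "T v \<le> rate" if v: "v \<in> W" for v
  proof -
    have inj: "inj_on (\<lambda>h. \<rho> h v) window" using good(2)[OF v] .
    have 1: "ent ?N (y v) = ent \<mu> B"
      unfolding y_def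
      by (rule ent_PiM_reindex[OF prob space B _ inj]) (auto simp: window_def intro: loc)
    \<comment> \<open>Seen from a good vertex, the outputs at its \<open>E\<close>-neighbours are
      the pattern of the pulled-back configuration. The composition law is needed only on
      \<open>D\<close> and \<open>E\<close>, because \<open>B\<close> reads only
      \<open>D\<close>.\<close>
    have eq: "(\<lambda>g\<in>E. Y x (\<rho> g v)) = pattern (\<lambda>h. x (\<rho> h v))" for x
    proof (rule ext)
      fix g
      show "(\<lambda>g\<in>E. Y x (\<rho> g v)) g = pattern (\<lambda>h. x (\<rho> h v)) g"
        using v W V(2) good(3)[OF v]
        by (auto simp: pattern_def Y_def y_def intro!: loc)
    qed
    \<comment> \<open>All outputs except those at the neighbours of \<open>v\<close> are
      forgotten.\<close>
    have "ent ?N (\<lambda>x. (P (x v), Y x)) - ent ?N Y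
        \<le> ent ?N (\<lambda>x. (P (x v), \<lambda>g\<in>E. Y x (\<rho> g v))) - ent ?N (\<lambda>x. \<lambda>g\<in>E. Y x (\<rho> g v))"
      using N.ent_cond_compose_le[OF simple_coordinate Y, of v "\<lambda>w. \<lambda>g\<in>E. w (\<rho> g v)"] .
    also have "ent ?N (\<lambda>x. \<lambda>g\<in>E. Y x (\<rho> g v)) = ent \<mu> pattern"
      unfolding eq by (rule ent_PiM_reindex[OF prob space simple_pattern pattern_local inj])
    also have "ent ?N (\<lambda>x. (P (x v), \<lambda>g\<in>E. Y x (\<rho> g v)))
        = ent ?N (\<lambda>x. (\<lambda>z. (P (z 0), pattern z)) (\<lambda>h. x (\<rho> h v)))"
      unfolding eq using good(1)[OF v] by simp
    also have "\<dots> = ent \<mu> (\<lambda>z. (P (z 0), pattern z))"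
      by (rule ent_PiM_reindex[OF prob space simple_function_Pair[OF simple_coordinate simple_pattern] _ inj])
        (auto simp: window_def intro!: pattern_local)
    finally show ?thesis by (simp add: T_def rate_def 1)
  qed
  have Tbad: "T v \<le> real (card (range B)) + real (card (range P))" for v
  proof -
    have "ent ?N (y v) \<le> card (range B)"
      using simple_functionD(1)[OF B] by (intro ent_le_card) (auto simp: y_def sp)
    moreover have "ent ?N (\<lambda>x. P (x v)) \<le> card (range P)"
      using simple_functionD(1)[OF P] by (intro ent_le_card) (auto simp: space)
    moreover have "ent ?N (\<lambda>x. (P (x v), Y x)) \<le> ent ?N (\<lambda>x. P (x v)) + ent ?N Y"
      by (intro N.ent_pair_le simple_coordinate Y)
    ultimately show ?thesis by (simp add: T_def)
  qed
  have "card V * ent \<mu> (\<lambda>x. P (x 0)) = ent ?N (\<lambda>x. \<lambda>v\<in>V. P (x v))"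
    by (simp add: ent_PiM_restrict[OF prob space P V(1)] ent_PiM_coordinate[OF prob space P])
  also have "\<dots> \<le> ent ?N (\<lambda>x. (\<lambda>v\<in>V. P (x v), Y x))"
    using N.ent_compose_le[OF simple_function_Pair[OF PV Y], of fst] by simp
  also have "\<dots> \<le> ent ?N Y + (\<Sum>v\<in>V. ent ?N (\<lambda>x. (P (x v), Y x)) - ent ?N Y)"
    using V(1) simple_coordinate Y by (rule N.ent_restrict_cond_le)
  also have "\<dots> \<le> (\<Sum>v\<in>V. ent ?N (y v)) + (\<Sum>v\<in>V. ent ?N (\<lambda>x. (P (x v), Y x)) - ent ?N Y)"
    using N.ent_restrict_le[OF V(1) y] by (simp add: Y_def[abs_def])
  also have "\<dots> = (\<Sum>v\<in>V. T v)"
    by (simp add: T_def sum.distrib)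
  also have "\<dots> = (\<Sum>v\<in>W. T v) + (\<Sum>v\<in>V - W. T v)"
    using sum.subset_diff[OF W V(1), of T] by simp
  also have "\<dots> \<le> card W * rate + card (V - W) * (real (card (range B)) + real (card (range P)))"
    using sum_bounded_above[of W T rate] sum_bounded_above[of "V - W" T] Tgood Tbad
    by (intro add_mono) auto
  finally show ?thesis .
qed

lemma sofic_inequality:
  assumes "sofic TYPE('g)"
  shows "ent \<mu> (\<lambda>x. P (x 0)) \<le> rate"
proof -
  obtain m :: "nat \<Rightarrow> nat" and \<sigma> :: "nat \<Rightarrow> 'g \<Rightarrow> nat \<Rightarrow> nat" and F :: "nat \<Rightarrow> 'g set" and \<epsilon> :: "nat \<Rightarrow> real"
    where m: "\<And>i. m i \<ge> 1" and perm: "\<And>i g. \<sigma> i g permutes {1..m i}"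
      and F: "\<And>i. F i \<subseteq> F (Suc i)" "(\<Union>i. F i) = UNIV" and \<epsilon>: "\<epsilon> \<longlonglongrightarrow> 0"
      and good: "\<And>i. real (card {v \<in> {1..m i}.
                 (\<forall>f1\<in>F i. \<forall>f2\<in>F i. \<sigma> i f1 (\<sigma> i f2 v) = \<sigma> i (f1 + f2) v) \<and>
                 (\<forall>f1\<in>F i. \<forall>f2\<in>F i. f1 \<noteq> f2 \<longrightarrow> \<sigma> i f1 v \<noteq> \<sigma> i f2 v)})
            \<ge> (1 - \<epsilon> i) * real (m i)"
    using assms unfolding sofic_def by blast
  \<comment> \<open>The elements that \<open>F i\<close> must contain for the model to be correct on
    the window; the inverses come from the sign in \<open>\<rho>\<close> below.\<close>
  define S where "S = uminus ` (window \<union> E)"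
  define K where "K = real (card (range B)) + real (card (range P))"
  have "finite S" using fin by (simp add: S_def window_def)
  moreover have "\<exists>i. S' \<subseteq> F i" if "finite S'" for S'
    using that
  proof (induction S' rule: finite_induct)
    case (insert s S')
    then obtain i where i: "S' \<subseteq> F i" by blast
    obtain j where j: "s \<in> F j" using F(2) by blast
    have "F i \<subseteq> F (max i j)" "F j \<subseteq> F (max i j)"
      using lift_Suc_mono_le[of F, OF F(1)] by simp_all
    with i j show ?case by blast
  qed simp
  ultimately obtain i0 where "S \<subseteq> F i0" by blast
  then have S: "S \<subseteq> F i" if "i \<ge> i0" for i
    using lift_Suc_mono_le[of F, OF F(1) that] by blast
  have "ent \<mu> (\<lambda>x. P (x 0)) \<le> rate + \<epsilon> i * K" if i: "i \<ge> i0" for i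
  proof -
    let ?V = "{1..m i}"
    define W where "W = {v \<in> ?V.
                 (\<forall>f1\<in>F i. \<forall>f2\<in>F i. \<sigma> i f1 (\<sigma> i f2 v) = \<sigma> i (f1 + f2) v) \<and>
                 (\<forall>f1\<in>F i. \<forall>f2\<in>F i. f1 \<noteq> f2 \<longrightarrow> \<sigma> i f1 v \<noteq> \<sigma> i f2 v)}"
    \<comment> \<open>The sign turns the left action into the right action \<open>\<rho> f (\<rho> g v) = \<rho> (g + f) v\<close>,
      which matches the translates \<open>\<lambda>f. x (g + f)\<close>.\<close>
    define \<rho> where "\<rho> h v = \<sigma> i (- h) v" for h v
    have mem: "- h \<in> F i" if "h \<in> window \<union> E" for h
      using S[OF i] that by (auto simp: S_def)
    have W: "W \<subseteq> ?V" by (auto simp: W_def)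
    have hom: "\<sigma> i f1 (\<sigma> i f2 v) = \<sigma> i (f1 + f2) v" if "v \<in> W" "f1 \<in> F i" "f2 \<in> F i" for v f1 f2
      using that by (auto simp: W_def)
    have dist: "f1 = f2" if "v \<in> W" "f1 \<in> F i" "f2 \<in> F i" "\<sigma> i f1 v = \<sigma> i f2 v" for v f1 f2
      using that by (auto simp: W_def)
    have "0 \<in> F i" using mem[of 0] by (simp add: window_def)
    have "card ?V * ent \<mu> (\<lambda>x. P (x 0)) \<le> card W * rate + card (?V - W) * K"
      unfolding K_def
    proof (rule model_inequality[where \<rho> = \<rho>])
      show "finite ?V" "W \<subseteq> ?V" using W by auto
      show "\<rho> h v \<in> ?V" if "v \<in> ?V" for h v
        using permutes_in_image[OF perm] that by (simp add: \<rho>_def del: atLeastAtMost_iff)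
      \<comment> \<open>Multiplicativity at \<open>0 + 0\<close> says that
        \<open>\<sigma> i 0\<close> fixes the image of \<open>v\<close> under itself; injectivity of
        the permutation then cancels one application.\<close>
      show "\<rho> 0 v = v" if "v \<in> W" for v
        using hom[OF that \<open>0 \<in> F i\<close> \<open>0 \<in> F i\<close>] permutes_inj[OF perm, of i 0] by (simp add: \<rho>_def inj_eq)
      show "inj_on (\<lambda>h. \<rho> h v) window" if "v \<in> W" for v
        using dist[OF that] mem by (fastforce simp: inj_on_def \<rho>_def)
      show "\<rho> f (\<rho> g v) = \<rho> (g + f) v" if "v \<in> W" "f \<in> D" "g \<in> E" for v f g
        using hom[of v "- f" "- g"] mem[of f] mem[of g] that by (simp add: \<rho>_def window_def minus_add)
    qed
    also have "card W * rate \<le> m i * rate"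
      using card_mono[OF _ W] rate_nonneg by (intro mult_right_mono) auto
    also have "card (?V - W) * K \<le> (\<epsilon> i * m i) * K"
    proof (rule mult_right_mono)
      have "real (card (?V - W)) = real (m i) - real (card W)"
        using card_mono[OF _ W] W by (subst card_Diff_subset) (simp_all add: finite_subset[OF W])
      also have "\<dots> \<le> \<epsilon> i * m i"
        using good[of i] by (simp add: W_def algebra_simps)
      finally show "real (card (?V - W)) \<le> \<epsilon> i * m i" .
    qed (simp add: K_def)
    finally have "m i * ent \<mu> (\<lambda>x. P (x 0)) \<le> m i * (rate + \<epsilon> i * K)"
      by (simp add: algebra_simps)
    then show ?thesis
      using m[of i] by simp
  qed
  then have "\<forall>\<^sub>F i in sequentially. ent \<mu> (\<lambda>x. P (x 0)) \<le> rate + \<epsilon> i * K"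
    by (auto simp: eventually_sequentially)
  moreover have "(\<lambda>i. rate + \<epsilon> i * K) \<longlonglongrightarrow> rate + 0 * K"
    by (intro tendsto_intros \<epsilon>)
  ultimately show ?thesis
    by (intro tendsto_lowerbound[of "\<lambda>i. rate + \<epsilon> i * K"]) auto
qed

end

section \<open>Approximation by finitely determined observables\<close>

text \<open>Serves only as a sigma-algebra; the probability measures in question live on the same
  measurable sets.\<close>

abbreviation config :: "('g \<Rightarrow> nat) measure" where
  "config \<equiv> PiM UNIV (\<lambda>_. count_space UNIV)"

text \<open>Locality in two senses at once: finitely many coordinates (when \<open>D\<close> is
  finite), and each only up to truncation at \<open>n\<close>. A decoder of this kind can be
  evaluated on finite-valued data.\<close>

definition determined :: "'g set \<Rightarrow> nat \<Rightarrow> (('g \<Rightarrow> nat) \<Rightarrow> 'a) \<Rightarrow> bool" where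
  "determined D n f \<longleftrightarrow> (\<forall>u w. (\<forall>g\<in>D. min (u g) n = min (w g) n) \<longrightarrow> f u = f w)"

lemma determined_mono:
  assumes "determined D n f" "D \<subseteq> D'" "n \<le> n'" shows "determined D' n' f"
  unfolding determined_def
proof (intro allI impI)
  fix u w :: "'a \<Rightarrow> nat" assume eq: "\<forall>g\<in>D'. min (u g) n' = min (w g) n'"
  have "min (u g) n = min (w g) n" if "g \<in> D" for g
  proof -
    have "min (min (u g) n') n = min (min (w g) n') n" using eq assms(2) that by auto
    then show ?thesis using assms(3) by (simp add: min.assoc min_absorb2)
  qed
  then show "f u = f w" using assms(1) unfolding determined_def by blast
qed

lemma determined_comp2:
  assumes "determined D n f" "determined D' n' f'"
  shows "determined (D \<union> D') (max n n') (\<lambda>u. h (f u) (f' u))"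
proof -
  have "determined (D \<union> D') (max n n') f" "determined (D \<union> D') (max n n') f'"
    using assms by (auto elim!: determined_mono)
  then show ?thesis unfolding determined_def by metis
qed

definition approximable :: "('g \<Rightarrow> nat) measure \<Rightarrow> ('g \<Rightarrow> nat) set \<Rightarrow> bool" where
  "approximable M A \<longleftrightarrow> A \<in> sets M \<and> (\<forall>\<delta>>0. \<exists>S D n. S \<in> sets M \<and> finite D \<and>
     determined D n (\<lambda>u. u \<in> S) \<and> measure M (sym_diff A S) < \<delta>)"

text \<open>No product structure is assumed, because approximation is needed under the law of the
  coded process as well as under the Bernoulli measure.\<close>

locale config_prob_space = prob_space M for M :: "('g \<Rightarrow> nat) measure" +
  assumes sets_config: "sets M = sets config"
begin

lemma space_config: "space M = UNIV"
  using sets_eq_imp_space_eq[OF sets_config] by (simp add: space_PiM)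

text \<open>The approximable events are closed in the measure of the symmetric difference, by the
  triangle inequality with \<open>\<delta> / 2\<close> twice.\<close>

lemma approximableI:
  assumes A: "A \<in> events" and B: "\<And>\<delta>. \<delta> > 0 \<Longrightarrow> \<exists>B. approximable M B \<and> prob (sym_diff A B) < \<delta>"
  shows "approximable M A"
  unfolding approximable_def
proof (intro conjI allI impI A)
  fix \<delta> :: real assume "\<delta> > 0"
  then obtain B where B: "approximable M B" "prob (sym_diff A B) < \<delta> / 2"
    using assms(2)[of "\<delta> / 2"] by auto
  then obtain S D n where S: "S \<in> events" "finite D" "determined D n (\<lambda>u. u \<in> S)" "prob (sym_diff B S) < \<delta> / 2"
    using \<open>\<delta> > 0\<close> unfolding approximable_def by (meson half_gt_zero)
  have Bm: "B \<in> events" using B(1) by (simp add: approximable_def)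
  have "prob (sym_diff A S) \<le> prob (sym_diff A B \<union> sym_diff B S)"
    using A Bm S(1) by (intro finite_measure_mono) auto
  also have "\<dots> \<le> prob (sym_diff A B) + prob (sym_diff B S)"
    using A Bm S(1) by (intro measure_Un_le) auto
  finally have "prob (sym_diff A S) < \<delta>" using B(2) S(4) by simp
  with S show "\<exists>S D n. S \<in> events \<and> finite D \<and> determined D n (\<lambda>u. u \<in> S) \<and> prob (sym_diff A S) < \<delta>"
    by blast
qed

lemma approximable_exact:
  "A \<in> events \<Longrightarrow> finite D \<Longrightarrow> determined D n (\<lambda>u. u \<in> A) \<Longrightarrow> approximable M A"
  unfolding approximable_def by (auto intro!: exI[of _ A])

lemma approximable_compl:
  assumes "approximable M A"
  shows "approximable M (- A)"
  unfolding approximable_def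
proof (intro conjI allI impI)
  have A: "A \<in> events" using assms by (simp add: approximable_def)
  show "- A \<in> events" using sets.compl_sets[OF A] by (simp add: space_config Compl_eq_Diff_UNIV)
  fix \<delta> :: real assume "\<delta> > 0"
  then obtain S D n where S: "S \<in> events" "finite D" "determined D n (\<lambda>u. u \<in> S)" "prob (sym_diff A S) < \<delta>"
    using assms unfolding approximable_def by blast
  have "sym_diff (- A) (- S) = sym_diff A S" by auto
  moreover have "- S \<in> events" using sets.compl_sets[OF S(1)] by (simp add: space_config Compl_eq_Diff_UNIV)
  moreover have "determined D n (\<lambda>u. u \<in> - S)" using S(3) by (simp add: determined_def)
  ultimately show "\<exists>S D n. S \<in> events \<and> finite D \<and> determined D n (\<lambda>u. u \<in> S) \<and> prob (sym_diff (- A) S) < \<delta>"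
    using S by (intro exI[of _ "- S"] exI[of _ D] exI[of _ n]) simp
qed

lemma approximable_Un:
  assumes "approximable M A" "approximable M B"
  shows "approximable M (A \<union> B)"
  unfolding approximable_def
proof (intro conjI allI impI)
  have A: "A \<in> events" "B \<in> events" using assms by (auto simp: approximable_def)
  then show "A \<union> B \<in> events" by blast
  fix \<delta> :: real assume "\<delta> > 0"
  then have "\<delta> / 2 > 0" by simp
  then obtain S D n S' D' n' where S: "S \<in> events" "finite D" "determined D n (\<lambda>u. u \<in> S)" "prob (sym_diff A S) < \<delta> / 2"
    and S': "S' \<in> events" "finite D'" "determined D' n' (\<lambda>u. u \<in> S')" "prob (sym_diff B S') < \<delta> / 2"
    using assms unfolding approximable_def by meson
  have "prob (sym_diff (A \<union> B) (S \<union> S')) \<le> prob (sym_diff A S \<union> sym_diff B S')"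
    using A S S' by (intro finite_measure_mono) auto
  also have "\<dots> \<le> prob (sym_diff A S) + prob (sym_diff B S')"
    using A S S' by (intro measure_Un_le) auto
  finally have "prob (sym_diff (A \<union> B) (S \<union> S')) < \<delta>" using S(4) S'(4) by simp
  moreover have "determined (D \<union> D') (max n n') (\<lambda>u. u \<in> S \<union> S')"
    using determined_comp2[OF S(3) S'(3), of "(\<or>)"] by simp
  ultimately show "\<exists>S D n. S \<in> events \<and> finite D \<and> determined D n (\<lambda>u. u \<in> S) \<and> prob (sym_diff (A \<union> B) S) < \<delta>"
    using S S' by (intro exI[of _ "S \<union> S'"] exI[of _ "D \<union> D'"] exI[of _ "max n n'"]) auto
qed

text \<open>Finite unions are already covered, and by continuity from below they exhaust the
  countable union in measure.\<close>

lemma approximable_UN: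
  assumes A: "\<And>k::nat. approximable M (A k)"
  shows "approximable M (\<Union>k. A k)"
proof (rule approximableI)
  have Am: "A k \<in> events" for k using A by (simp add: approximable_def)
  then show m: "(\<Union>k. A k) \<in> events" by blast
  define U where "U n = (\<Union>k<n. A k)" for n
  have Um: "U n \<in> events" for n using Am by (auto simp: U_def)
  have U: "approximable M (U n)" for n
  proof (induction n)
    case 0
    then show ?case
      by (auto simp: U_def determined_def intro!: approximable_exact[of _ "{}" 0])
  next
    case (Suc n)
    then show ?case
      using approximable_Un[OF Suc A[of n]] by (simp add: U_def lessThan_Suc Un_commute)
  qed
  fix \<delta> :: real assume "\<delta> > 0"
  have "(\<lambda>n. prob (U n)) \<longlonglongrightarrow> prob (\<Union>n. U n)"
    using Um by (intro finite_Lim_measure_incseq) (auto simp: incseq_def U_def intro: less_le_trans)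
  also have "(\<Union>n. U n) = (\<Union>k. A k)" by (auto simp: U_def)
  finally obtain n where n: "\<bar>prob (U n) - prob (\<Union>k. A k)\<bar> < \<delta>"
    using \<open>\<delta> > 0\<close> by (fastforce simp: LIMSEQ_def dist_real_def)
  have "U n \<subseteq> (\<Union>k. A k)" by (auto simp: U_def)
  then have "prob ((\<Union>k. A k) - U n) = prob (\<Union>k. A k) - prob (U n)"
      "sym_diff (\<Union>k. A k) (U n) = (\<Union>k. A k) - U n"
    using m Um by (auto intro!: finite_measure_Diff)
  with n have "prob (sym_diff (\<Union>k. A k) (U n)) < \<delta>" by simp
  with U show "\<exists>B. approximable M B \<and> prob (sym_diff (\<Union>k. A k) B) < \<delta>" by blast
qed

lemma approximable_all:
  assumes A: "A \<in> events"
  shows "approximable M A"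
proof -
  have gen: "approximable M {u. u g \<in> J}" for g and J :: "nat set"
  proof -
    have "approximable M (if j \<in> J then {u. u g = j} else {})" for j
    \<comment> \<open>The level must exceed \<open>j\<close>: truncation at \<open>j\<close> would
      identify \<open>j\<close> with all larger values. An infinite \<open>J\<close> has no such
      level in general, hence the countable union over its elements.\<close>
    proof (rule approximable_exact[where D = "{g}" and n = "Suc j"])
      have "{u \<in> space config. u g = j} \<in> sets config" by measurable
      then show "(if j \<in> J then {u. u g = j} else {}) \<in> events" by (simp add: sets_config space_PiM)
      show "determined {g} (Suc j) (\<lambda>u. u \<in> (if j \<in> J then {u. u g = j} else {}))"
        by (auto simp: determined_def min_def split: if_splits)
    qed simp
    from approximable_UN[OF this] show ?thesis
      by (rule back_subst[of "approximable M"]) (auto split: if_splits)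
  qed
  have "A \<in> sigma_sets UNIV {{u. u g \<in> J} | g J. True}"
    using A unfolding sets_config by (simp add: sets_PiM_single)
  then show ?thesis
  proof induction
    case (Basic a)
    then show ?case using gen by blast
  next
    case Empty
    then show ?case by (auto simp: determined_def intro!: approximable_exact[of _ "{}" 0])
  next
    case (Compl a)
    then show ?case using approximable_compl by (simp add: Compl_eq_Diff_UNIV)
  next
    case (Union a)
    then show ?case by (intro approximable_UN)
  qed
qed

text \<open>Approximations of the level sets of \<open>c\<close> chosen independently could overlap.
  The induction avoids this: it approximates \<open>c\<close> cut off at \<open>N\<close> and then
  overwrites by \<open>Suc N\<close> on a local event close to the top level set.\<close>

lemma bounded_function_approximation:
  assumes c: "c \<in> measurable M (count_space UNIV)" "\<And>u. c u \<le> (N::nat)" and \<delta>: "\<delta> > 0"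
  shows "\<exists>c' D n. c' \<in> measurable M (count_space UNIV) \<and> (\<forall>u. c' u \<le> N) \<and> finite D \<and> determined D n c' \<and>
    measure M {u. c' u \<noteq> c u} < \<delta>"
  using c \<delta>
proof (induction N arbitrary: c \<delta>)
  case 0
  then show ?case
    by (intro exI[of _ "\<lambda>_. 0"] exI[of _ "{}"] exI[of _ 0]) (auto simp: determined_def)
next
  case (Suc N)
  note Suc.prems(1)[measurable]
  have [measurable]: "(\<lambda>u. min (c u) N) \<in> measurable M (count_space UNIV)"
    using measurable_compose[OF Suc.prems(1), of "\<lambda>k. min k N"] by simp
  then obtain c0 D n where c0[measurable]: "c0 \<in> measurable M (count_space UNIV)"
    and c0': "\<And>u. c0 u \<le> N" "finite D" "determined D n c0" "prob {u. c0 u \<noteq> min (c u) N} < \<delta> / 2"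
    using Suc.IH[of "\<lambda>u. min (c u) N" "\<delta> / 2"] Suc.prems by (auto simp del: min_less_iff_conj)
  define A where "A = {u. c u = Suc N}"
  have "{u \<in> space M. c u = Suc N} \<in> events" by measurable
  then have A: "A \<in> events" by (simp add: A_def space_config)
  then obtain S D' n' where S: "S \<in> events" "finite D'" "determined D' n' (\<lambda>u. u \<in> S)" "prob (sym_diff A S) < \<delta> / 2"
    using approximable_all[OF A] Suc.prems(3) unfolding approximable_def by (meson half_gt_zero)
  define c' where "c' u = (if u \<in> S then Suc N else c0 u)" for u
  have [measurable]: "c' \<in> measurable M (count_space UNIV)"
    unfolding c'_def using S(1) by measurable
  have "{u \<in> space M. c0 u \<noteq> min (c u) N} \<in> events" by measurable
  then have m0: "{u. c0 u \<noteq> min (c u) N} \<in> events" by (simp add: space_config)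
  have "{u. c' u \<noteq> c u} \<subseteq> {u. c0 u \<noteq> min (c u) N} \<union> sym_diff A S"
  proof
    fix u assume "u \<in> {u. c' u \<noteq> c u}"
    then show "u \<in> {u. c0 u \<noteq> min (c u) N} \<union> sym_diff A S"
      using Suc.prems(2)[of u] by (auto simp: c'_def A_def min_def le_Suc_eq split: if_splits)
  qed
  then have "prob {u. c' u \<noteq> c u} \<le> prob ({u. c0 u \<noteq> min (c u) N} \<union> sym_diff A S)"
    using m0 A S by (intro finite_measure_mono) auto
  also have "\<dots> \<le> prob {u. c0 u \<noteq> min (c u) N} + prob (sym_diff A S)"
    using m0 A S by (intro measure_Un_le) auto
  finally have "prob {u. c' u \<noteq> c u} < \<delta>" using c0'(4) S(4) by simp
  moreover have "determined (D \<union> D') (max n n') c'"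
    unfolding c'_def using determined_comp2[OF c0'(3) S(3), of "\<lambda>a s. if s then Suc N else a"] by simp
  moreover have "c' u \<le> Suc N" for u using c0'(1)[of u] by (simp add: c'_def)
  ultimately show ?case
    using c0'(2) S(2) by (intro exI[of _ c'] exI[of _ "D \<union> D'"] exI[of _ "max n n'"]) auto
qed

end

section \<open>Entropy of a generating observable\<close>

locale generating_observable =
  fixes p :: "nat measure" and b c :: "('g::group_add \<Rightarrow> nat) \<Rightarrow> nat"
  assumes sofic: "sofic TYPE('g)"
    and p: "prob_space p" "sets p = sets (count_space UNIV)"
    and b: "b \<in> measurable config (count_space UNIV)"
    and c: "c \<in> measurable config (count_space UNIV)"
    and generating: "AE u in PiM UNIV (\<lambda>_. p). c (\<lambda>g. b (\<lambda>f. u (g + f))) = u 0"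
begin

abbreviation \<mu> :: "('g \<Rightarrow> nat) measure" where
  "\<mu> \<equiv> PiM UNIV (\<lambda>_. p)"

text \<open>The process of all translates of \<open>b\<close>; the generating assumption reads
  \<open>c (code u) = u 0\<close> almost everywhere.\<close>

definition code :: "('g \<Rightarrow> nat) \<Rightarrow> 'g \<Rightarrow> nat" where
  "code u = (\<lambda>g. b (\<lambda>f. u (g + f)))"

lemma space_p: "space p = UNIV"
  using sets_eq_imp_space_eq[OF p(2)] by simp

lemma space_\<mu>: "space \<mu> = UNIV"
  by (rule space_PiM_UNIV[OF space_p])

lemma sets_\<mu> [measurable_cong]: "sets \<mu> = sets config"
  using p(2) by (intro sets_PiM_cong) auto

lemma prob_\<mu>: "prob_space \<mu>"
  using p(1) by (intro prob_space_PiM)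

lemma config_\<mu>: "config_prob_space \<mu>"
  using prob_\<mu> sets_\<mu> by (simp add: config_prob_space_def config_prob_space_axioms_def)

lemma simple_\<mu>I:
  fixes X :: "('g \<Rightarrow> nat) \<Rightarrow> nat"
  assumes "X \<in> measurable config (count_space UNIV)" "\<And>u. X u \<le> n"
  shows "simple_function \<mu> X"
proof -
  have "finite (X ` space \<mu>)"
    by (rule finite_subset[of _ "{..n}"]) (use assms in auto)
  then show ?thesis
    using assms(1) by (simp add: simple_function_eq_measurable measurable_cong_sets[OF sets_\<mu> refl])
qed

lemma measurable_code: "code \<in> measurable \<mu> config"
proof -
  have "(\<lambda>u. code u g) \<in> measurable \<mu> (count_space UNIV)" for g
    unfolding code_def
    by (rule measurable_compose[OF measurable_PiM_reindex])
      (use b in \<open>simp add: measurable_cong_sets[OF sets_\<mu> refl]\<close>)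
  then show ?thesis
    by (intro measurable_PiM_single') (auto simp: space_PiM)
qed

text \<open>Local rules approximating \<open>min (b u) n\<close> satisfy the sofic inequality with
  decoding window \<open>D\<close>. Since \<open>D\<close>, \<open>n\<close> and \<open>N\<close>
  stay fixed, all entropies involved converge. In the limit the pattern on \<open>D\<close>
  determines \<open>c' (code u)\<close>, so conditioning on the latter is weaker.\<close>

lemma truncated_inequality:
  assumes c': "c' \<in> measurable config (count_space UNIV)" "\<And>u. c' u \<le> N"
    and D: "finite D" "determined D n c'"
  shows "ent \<mu> (\<lambda>u. min (u 0) N) \<le> ent \<mu> (\<lambda>u. min (b u) n)
    + (ent \<mu> (\<lambda>u. (min (u 0) N, c' (code u))) - ent \<mu> (\<lambda>u. c' (code u)))"
proof -
  interpret prob_space \<mu> by (rule prob_\<mu>)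
  define \<beta> where "\<beta> u = min (b u) n" for u
  have \<beta>m: "\<beta> \<in> measurable config (count_space UNIV)"
    unfolding \<beta>_def[abs_def] using measurable_compose[OF b, of "\<lambda>k. min k n"] by simp
  have \<beta>: "simple_function \<mu> \<beta>"
    by (rule simple_\<mu>I[OF \<beta>m, of n]) (simp add: \<beta>_def)
  define approx where "approx l B D' n' \<longleftrightarrow> B \<in> measurable \<mu> (count_space UNIV) \<and> (\<forall>u. B u \<le> n) \<and>
    finite D' \<and> determined D' n' B \<and> prob {u. B u \<noteq> \<beta> u} < 1 / real (Suc l)" for l B D' n'
  have "\<exists>B D' n'. approx l B D' n'" for l
    unfolding approx_def
    by (rule config_prob_space.bounded_function_approximation[OF config_\<mu>])
      (auto simp: measurable_cong_sets[OF sets_\<mu> refl] \<beta>m, simp add: \<beta>_def)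
  then obtain B D' n' where "\<And>l. approx l (B l) (D' l) (n' l)"
    by metis
  then have Bm: "\<And>l. B l \<in> measurable \<mu> (count_space UNIV)" and Bn: "\<And>l u. B l u \<le> n"
    and D': "\<And>l. finite (D' l)" "\<And>l. determined (D' l) (n' l) (B l)"
    and B\<beta>: "\<And>l. prob {u. B l u \<noteq> \<beta> u} < 1 / real (Suc l)"
    unfolding approx_def by blast+
  have B: "simple_function \<mu> (B l)" for l
    by (rule simple_\<mu>I[of _ n]) (use Bm Bn in \<open>auto simp: measurable_cong_sets[OF sets_\<mu> refl]\<close>)
  define pat where "pat X u = (\<lambda>g\<in>D. X (\<lambda>f. u (g + f)))" for X :: "('g \<Rightarrow> nat) \<Rightarrow> nat" and u
  define P0 where "P0 u = min (u 0) N" for u :: "'g \<Rightarrow> nat"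
  have P: "simple_function p (\<lambda>k. min k N)"
    unfolding simple_function_eq_measurable
    by (auto intro!: finite_subset[of _ "{..N}"] simp: measurable_cong_sets[OF p(2) refl])
  have P0: "simple_function \<mu> P0"
    unfolding P0_def by (rule simple_function_comp[OF _ P]) simp
  have spat: "simple_function \<mu> (pat X)" if "simple_function \<mu> X" for X
  proof -
    have "simple_function \<mu> (\<lambda>u. X (\<lambda>f. u (g + f)))" for g
      by (rule simple_function_comp[OF measurable_PiM_reindex[of "(+) g"] that])
    then show ?thesis
      unfolding pat_def by (rule simple_function_restrict[OF D(1)])
  qed
  have ineq: "ent \<mu> P0 \<le> ent \<mu> (B l) + (ent \<mu> (\<lambda>u. (P0 u, pat (B l) u)) - ent \<mu> (pat (B l)))" for l
  proof -
    interpret L: local_observable p "B l" "\<lambda>k. min k N" "D' l" D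
    proof (rule local_observable.intro)
      fix x y :: "'g \<Rightarrow> nat" assume "\<And>h. h \<in> D' l \<Longrightarrow> x h = y h"
      then show "B l x = B l y" using D'(2)[of l] by (auto simp: determined_def)
    qed (fact p(1) space_p B P D'(1) D(1))+
    show ?thesis
      using L.sofic_inequality[OF sofic] unfolding L.rate_def L.pattern_def[abs_def] pat_def[abs_def] P0_def[abs_def] .
  qed
  have lim0: "(\<lambda>l. prob {u. B l u \<noteq> \<beta> u}) \<longlonglongrightarrow> 0"
    by (rule Lim_null_comparison[OF _ LIMSEQ_inverse_real_of_nat])
      (use B\<beta> in \<open>auto intro!: always_eventually less_imp_le simp: inverse_eq_divide\<close>)
  have neqm: "{u. B l u \<noteq> \<beta> u} \<in> sets \<mu>" for l
    using simple_function_vimage_sets(1)[OF simple_function_Pair[OF B \<beta>], of l "{(a, b). a \<noteq> b}"]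
    by (simp add: space_\<mu>)
  \<comment> \<open>Union bound over \<open>D\<close>: patterns differ only if some translate of the
    rules does, and translation preserves the Bernoulli measure.\<close>
  have "prob {u. pat (B l) u \<noteq> pat \<beta> u} \<le> card D * prob {u. B l u \<noteq> \<beta> u}" for l
  proof -
    let ?S = "\<lambda>g. {u. (\<lambda>f. u (g + f)) \<in> {u. B l u \<noteq> \<beta> u}}"
    have S: "?S g \<in> sets \<mu>" for g
      using measurable_sets[OF measurable_PiM_reindex[of "(+) g"] neqm[of l]]
      by (simp add: vimage_def space_\<mu>)
    have "{u. pat (B l) u \<noteq> pat \<beta> u} \<subseteq> (\<Union>g\<in>D. ?S g)"
      by (auto simp: pat_def intro!: restrict_ext)
    then have "prob {u. pat (B l) u \<noteq> pat \<beta> u} \<le> prob (\<Union>g\<in>D. ?S g)"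
      using S D(1) by (intro finite_measure_mono sets.finite_UN) auto
    also have "\<dots> \<le> (\<Sum>g\<in>D. prob (?S g))"
      using S D(1) by (intro measure_UNION_le) auto
    also have "\<dots> = (\<Sum>g\<in>D. prob {u. B l u \<noteq> \<beta> u})"
    proof (intro sum.cong refl measure_PiM_reindex[OF p(1) space_p neqm, where H = UNIV])
      fix x y :: "'g \<Rightarrow> nat" assume "\<And>h. h \<in> UNIV \<Longrightarrow> x h = y h"
      then have "x = y" by auto
      then show "x \<in> {u. B l u \<noteq> \<beta> u} \<longleftrightarrow> y \<in> {u. B l u \<noteq> \<beta> u}" by simp
    qed auto
    finally show ?thesis by simp
  qed
  then have lim1: "(\<lambda>l. prob {u. pat (B l) u \<noteq> pat \<beta> u}) \<longlonglongrightarrow> 0"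
    by (intro Lim_null_comparison[OF _ tendsto_mult_right_zero[OF lim0, of "card D"]]) (auto intro!: always_eventually)
  have "(\<lambda>l. ent \<mu> (B l)) \<longlonglongrightarrow> ent \<mu> \<beta>"
    using Bn lim0 by (intro ent_tendsto[of "{..n}"] B \<beta>) (auto simp: \<beta>_def space_\<mu>)
  moreover have "(\<lambda>l. ent \<mu> (pat (B l))) \<longlonglongrightarrow> ent \<mu> (pat \<beta>)"
    using Bn lim1 D(1) by (intro ent_tendsto[of "PiE D (\<lambda>_. {..n})"] spat B \<beta>)
      (auto simp: \<beta>_def space_\<mu> pat_def intro!: finite_PiE)
  moreover have "(\<lambda>l. ent \<mu> (\<lambda>u. (P0 u, pat (B l) u))) \<longlonglongrightarrow> ent \<mu> (\<lambda>u. (P0 u, pat \<beta> u))"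
    using Bn lim1 D(1) by (intro ent_tendsto[of "{..N} \<times> PiE D (\<lambda>_. {..n})"] simple_function_Pair P0 spat B \<beta>)
      (auto simp: \<beta>_def space_\<mu> pat_def P0_def intro!: finite_PiE)
  ultimately have "(\<lambda>l. ent \<mu> (B l) + (ent \<mu> (\<lambda>u. (P0 u, pat (B l) u)) - ent \<mu> (pat (B l))))
      \<longlonglongrightarrow> ent \<mu> \<beta> + (ent \<mu> (\<lambda>u. (P0 u, pat \<beta> u)) - ent \<mu> (pat \<beta>))"
    by (intro tendsto_intros)
  then have "ent \<mu> P0 \<le> ent \<mu> \<beta> + (ent \<mu> (\<lambda>u. (P0 u, pat \<beta> u)) - ent \<mu> (pat \<beta>))"
    by (rule LIMSEQ_le_const) (use ineq in auto)
  \<comment> \<open>The filler 0 off \<open>D\<close> is not seen by \<open>c'\<close>, and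
    truncating at \<open>n\<close> a second time changes nothing.\<close>
  moreover have "c' (code u) = c' (\<lambda>g. if g \<in> D then pat \<beta> u g else 0)" for u
    using D(2) by (auto simp: determined_def pat_def code_def \<beta>_def)
  then have "ent \<mu> (\<lambda>u. (P0 u, pat \<beta> u)) - ent \<mu> (pat \<beta>)
      \<le> ent \<mu> (\<lambda>u. (P0 u, c' (code u))) - ent \<mu> (\<lambda>u. c' (code u))"
    using ent_cond_compose_le[OF P0 spat[OF \<beta>], of "\<lambda>w. c' (\<lambda>g. if g \<in> D then w g else 0)"] by simp
  ultimately show ?thesis
    unfolding P0_def[abs_def] \<beta>_def[abs_def] by simp
qed

text \<open>As the decoders improve, the conditional entropy of the truncated label given the
  decoded one tends to 0. Phrasing both sides by partial sums avoids any infinite-valued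
  entropy.\<close>

lemma generating_entropy_le:
  assumes S: "\<And>n. (\<Sum>j<n. eta (measure \<mu> {u. b u = j})) \<le> S"
  shows "(\<Sum>j<N. eta (measure p {j})) \<le> S"
proof -
  interpret prob_space \<mu> by (rule prob_\<mu>)
  define P0 where "P0 u = min (u 0) N" for u :: "'g \<Rightarrow> nat"
  let ?\<nu> = "distr \<mu> config code"
  have \<nu>: "config_prob_space ?\<nu>"
    using prob_space_distr[OF measurable_code]
    by (simp add: config_prob_space_def config_prob_space_axioms_def)
  have cN: "(\<lambda>w. min (c w) N) \<in> measurable config (count_space UNIV)"
    using measurable_compose[OF c, of "\<lambda>k. min k N"] by simp
  define approx where "approx k c' D n \<longleftrightarrow> c' \<in> measurable config (count_space UNIV) \<and> (\<forall>u. c' u \<le> N) \<and>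
    finite D \<and> determined D n c' \<and> measure ?\<nu> {w. c' w \<noteq> min (c w) N} < 1 / real (Suc k)" for k c' D n
  have "\<exists>c' D n. approx k c' D n" for k
    using config_prob_space.bounded_function_approximation[OF \<nu>, of "\<lambda>w. min (c w) N" N "1 / real (Suc k)"] cN
    by (simp add: approx_def)
  then obtain c' D n0 where "\<And>k. approx k (c' k) (D k) (n0 k)"
    by metis
  then have c'm: "\<And>k. c' k \<in> measurable config (count_space UNIV)" and c'N: "\<And>k u. c' k u \<le> N"
    and D: "\<And>k. finite (D k)" "\<And>k. determined (D k) (n0 k) (c' k)"
    and c': "\<And>k. measure ?\<nu> {w. c' k w \<noteq> min (c w) N} < 1 / real (Suc k)"
    unfolding approx_def by blast+
  \<comment> \<open>Raising the level keeps the decoder determined and forces the tail of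
    \<open>b\<close> beyond it to vanish.\<close>
  define n where "n k = max (n0 k) k" for k
  define Q where "Q k u = c' k (code u)" for k u
  define tail where "tail n = prob {u. n \<le> b u}" for n
  have det: "determined (D k) (n k) (c' k)" for k
    using determined_mono[OF D(2)] by (simp add: n_def)
  have P: "simple_function p (\<lambda>k. min k N)"
    unfolding simple_function_eq_measurable
    by (auto intro!: finite_subset[of _ "{..N}"] simp: measurable_cong_sets[OF p(2) refl])
  have P0: "simple_function \<mu> P0"
    unfolding P0_def by (rule simple_function_comp[OF _ P]) simp
  have Q: "simple_function \<mu> (Q k)" for k
    unfolding Q_def simple_function_eq_measurable using c'N measurable_compose[OF measurable_code c'm]
    by (auto intro!: finite_subset[of _ "{..N}"])
  have neqm: "{u. Q k u \<noteq> P0 u} \<in> sets \<mu>" for k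
    using simple_function_vimage_sets(1)[OF simple_function_Pair[OF Q P0], of k "{(a, b). a \<noteq> b}"]
    by (simp add: space_\<mu>)
  \<comment> \<open>The error of the decoder is measured under the law of \<open>code\<close>; by
    the generating property it equals the error in guessing the truncated coordinate.\<close>
  have QP: "prob {u. Q k u \<noteq> P0 u} < 1 / real (Suc k)" for k
  proof -
    have "simple_function config (\<lambda>w. (c' k w, min (c w) N))"
      using c'm cN c'N by (intro simple_function_Pair)
        (auto simp: simple_function_eq_measurable intro!: finite_subset[of _ "{..N}"])
    from simple_function_vimage_sets(1)[OF this, of "{(a, b). a \<noteq> b}"]
    have m: "{w. c' k w \<noteq> min (c w) N} \<in> sets config"
      by (simp add: space_PiM)
    have m': "{u. Q k u \<noteq> min (c (code u)) N} \<in> sets \<mu>"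
      using measurable_sets[OF measurable_code m] by (simp add: vimage_def space_\<mu> Q_def)
    have "prob {u. Q k u \<noteq> P0 u} = prob {u. Q k u \<noteq> min (c (code u)) N}"
      using generating by (intro finite_measure_eq_AE neqm m') (auto simp: code_def P0_def)
    also have "\<dots> = measure ?\<nu> {w. c' k w \<noteq> min (c w) N}"
      by (subst measure_distr[OF measurable_code m]) (simp add: vimage_def space_\<mu> Q_def)
    finally show ?thesis using c'[of k] by simp
  qed
  have lim0: "(\<lambda>k. prob {u. Q k u \<noteq> P0 u}) \<longlonglongrightarrow> 0"
    by (rule Lim_null_comparison[OF _ LIMSEQ_inverse_real_of_nat])
      (use QP in \<open>auto intro!: always_eventually less_imp_le simp: inverse_eq_divide\<close>)
  have "(\<lambda>k. ent \<mu> (Q k)) \<longlonglongrightarrow> ent \<mu> P0"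
    using c'N lim0 by (intro ent_tendsto[of "{..N}"] Q P0) (auto simp: P0_def Q_def space_\<mu>)
  moreover have "(\<lambda>k. ent \<mu> (\<lambda>u. (P0 u, Q k u))) \<longlonglongrightarrow> ent \<mu> (\<lambda>u. (P0 u, P0 u))"
    using c'N lim0 by (intro ent_tendsto[of "{..N} \<times> {..N}"] simple_function_Pair Q P0)
      (auto simp: P0_def Q_def space_\<mu>)
  moreover have "ent \<mu> (\<lambda>u. (P0 u, P0 u)) = ent \<mu> P0"
    using ent_compose_le[OF P0, of "\<lambda>a. (a, a)"] ent_compose_le[OF simple_function_Pair[OF P0 P0], of fst]
    by simp
  moreover have "(\<lambda>k. eta (tail (n k))) \<longlonglongrightarrow> eta 0"
  proof (rule continuous_on_tendsto_compose[OF continuous_on_eta])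
    have bm: "{u. k \<le> b u} \<in> sets \<mu>" for k
      using measurable_sets[OF b, of "{k..}"] by (simp add: sets_\<mu> vimage_def space_PiM)
    then have "tail \<longlonglongrightarrow> prob (\<Inter>k. {u. k \<le> b u})"
      unfolding tail_def by (intro finite_Lim_measure_decseq) (auto simp: decseq_def)
    also have "(\<Inter>k. {u. k \<le> b u}) = {}"
      using Suc_n_not_le_n by blast
    finally have "tail \<longlonglongrightarrow> 0" by simp
    moreover have "filterlim n sequentially sequentially"
      by (rule filterlim_at_top_mono[OF filterlim_ident]) (auto simp: n_def)
    ultimately show "(\<lambda>k. tail (n k)) \<longlonglongrightarrow> 0" by (rule filterlim_compose)
  qed (auto simp: tail_def)
  ultimately have "(\<lambda>k. S + eta (tail (n k)) + (ent \<mu> (\<lambda>u. (P0 u, Q k u)) - ent \<mu> (Q k)))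
      \<longlonglongrightarrow> S + eta 0 + (ent \<mu> P0 - ent \<mu> P0)"
    by (intro tendsto_intros) simp_all
  moreover have "ent \<mu> P0 \<le> S + eta (tail (n k)) + (ent \<mu> (\<lambda>u. (P0 u, Q k u)) - ent \<mu> (Q k))" for k
  proof -
    \<comment> \<open>Truncation leaves the atoms below \<open>n k\<close> unchanged and merges the
      rest into one, which contributes the tail term.\<close>
    have "ent \<mu> (\<lambda>u. min (b u) (n k)) = (\<Sum>j\<in>{..n k}. eta (prob {u. min (b u) (n k) = j}))"
      by (subst ent_eq_sum[of "{..n k}"]) (auto simp: space_\<mu>)
    also have "\<dots> = (\<Sum>j<n k. eta (prob {u. min (b u) (n k) = j})) + eta (prob {u. min (b u) (n k) = n k})"
      by (simp add: lessThan_Suc_atMost[symmetric])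
    also have "(\<Sum>j<n k. eta (prob {u. min (b u) (n k) = j})) = (\<Sum>j<n k. eta (prob {u. b u = j}))"
      by (intro sum.cong refl arg_cong[where f = "\<lambda>A. eta (prob A)"]) (auto simp: min_def)
    also have "\<dots> \<le> S" by (rule S)
    also have "{u. min (b u) (n k) = n k} = {u. n k \<le> b u}" by (auto simp: min_def)
    finally show ?thesis
      using truncated_inequality[OF c'm c'N D(1) det, of k] by (simp add: P0_def[abs_def] Q_def[abs_def] tail_def)
  qed
  ultimately have "ent \<mu> P0 \<le> S + eta 0 + (ent \<mu> P0 - ent \<mu> P0)"
    by (intro LIMSEQ_le_const) auto
  moreover have "(\<Sum>j<N. eta (measure p {j})) \<le> ent \<mu> P0"
  proof -
    have "ent \<mu> P0 = ent p (\<lambda>k. min k N)"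
      unfolding P0_def by (rule ent_PiM_coordinate[OF p(1) space_p P])
    also have "\<dots> = (\<Sum>j\<in>{..N}. eta (measure p {k. min k N = j}))"
      by (subst ent_eq_sum[of "{..N}"]) (auto simp: space_p)
    also have "\<dots> = (\<Sum>j<N. eta (measure p {k. min k N = j})) + eta (measure p {k. min k N = N})"
      by (simp add: lessThan_Suc_atMost[symmetric])
    also have "(\<Sum>j<N. eta (measure p {k. min k N = j})) = (\<Sum>j<N. eta (measure p {j}))"
      by (intro sum.cong refl arg_cong[where f = "\<lambda>A. eta (measure p A)"]) (auto simp: min_def)
    finally show ?thesis
      using prob_space.prob_le_1[OF p(1)] by (simp add: eta_nonneg)
  qed
  ultimately show ?thesis by simp
qed

end

section \<open>Reduction to integer alphabets\<close>

text \<open>Both measures give every finite cylinder the same product of fibre masses, and cylinders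
  determine the product measure.\<close>

lemma PiM_distr_count_space:
  fixes \<kappa> :: "'k measure" and r :: "'k \<Rightarrow> nat"
  assumes \<kappa>: "prob_space \<kappa>" "space \<kappa> = UNIV" and r: "r \<in> measurable \<kappa> (count_space UNIV)"
  shows "distr (PiM UNIV (\<lambda>_::'g. \<kappa>)) config (\<lambda>x g. r (x g)) = PiM UNIV (\<lambda>_. distr \<kappa> (count_space UNIV) r)"
proof -
  let ?p = "distr \<kappa> (count_space UNIV) r"
  interpret K: product_prob_space "\<lambda>_::'g. \<kappa>" UNIV
    using \<kappa> by (intro product_prob_spaceI)
  interpret R: product_prob_space "\<lambda>_::'g. ?p" UNIV
    using \<kappa>(1) r by (intro product_prob_spaceI prob_space.prob_space_distr)
  have rm: "(\<lambda>x g. r (x g)) \<in> measurable (PiM UNIV (\<lambda>_::'g. \<kappa>)) config"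
    by (intro measurable_PiM_single') (auto intro: measurable_compose[OF _ r])
  show ?thesis
  proof (rule R.PiM_eq)
    show "sets (distr (PiM UNIV (\<lambda>_::'g. \<kappa>)) config (\<lambda>x g. r (x g))) = sets (PiM UNIV (\<lambda>_. ?p))"
      by (simp, intro sets_PiM_cong) auto
    fix J :: "'g set" and F assume J: "finite J" "J \<subseteq> UNIV" "\<And>j. j \<in> J \<Longrightarrow> F j \<in> sets ?p"
    have emb: "prod_emb UNIV (\<lambda>_. ?p) J (Pi\<^sub>E J F) = {u. \<forall>j\<in>J. u j \<in> F j}"
      by (auto simp: prod_emb_def space_PiM)
    have emb': "prod_emb UNIV (\<lambda>_. \<kappa>) J (Pi\<^sub>E J (\<lambda>j. r -` F j)) = {x. \<forall>j\<in>J. r (x j) \<in> F j}"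
      by (auto simp: prod_emb_def space_PiM \<kappa>)
    have m: "{u. \<forall>j\<in>J. u j \<in> F j} \<in> sets config"
    proof -
      have "{u \<in> space config. \<forall>j\<in>J. u j \<in> F j} \<in> sets config"
        using J(1) by measurable
      then show ?thesis by (simp add: space_PiM)
    qed
    have rF: "r -` F j \<in> sets \<kappa>" for j
      using measurable_sets[OF r, of "F j"] by (simp add: \<kappa>)
    have "emeasure (distr (PiM UNIV (\<lambda>_::'g. \<kappa>)) config (\<lambda>x g. r (x g))) {u. \<forall>j\<in>J. u j \<in> F j}
        = emeasure (PiM UNIV (\<lambda>_::'g. \<kappa>)) {x. \<forall>j\<in>J. r (x j) \<in> F j}"
      by (subst emeasure_distr[OF rm m]) (simp add: vimage_def space_PiM \<kappa>)
    also have "\<dots> = (\<Prod>j\<in>J. emeasure \<kappa> (r -` F j))"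
      unfolding emb'[symmetric] using J(1) rF by (intro K.emeasure_PiM_emb) auto
    also have "\<dots> = (\<Prod>j\<in>J. emeasure ?p (F j))"
      by (intro prod.cong refl) (subst emeasure_distr[OF r], auto simp: \<kappa>)
    finally show "emeasure (distr (PiM UNIV (\<lambda>_::'g. \<kappa>)) config (\<lambda>x g. r (x g))) (prod_emb UNIV (\<lambda>_. ?p) J (Pi\<^sub>E J F))
        = (\<Prod>j\<in>J. emeasure ?p (F j))"
      by (simp only: emb)
  qed
qed

text \<open>Finite entropy forces a countable set of full measure. Enumerating it yields integer
  labels that lose information only on a null set.\<close>

lemma shannon_entropy_coding:
  fixes \<kappa> :: "'k::polish_space measure"
  assumes \<kappa>: "std_borel_prob \<kappa>" and fin: "shannon_entropy \<kappa> < \<infinity>"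
  obtains r :: "'k \<Rightarrow> nat" and s :: "nat \<Rightarrow> 'k"
  where "r \<in> measurable \<kappa> (count_space UNIV)" "AE x in \<kappa>. s (r x) = x"
    "shannon_entropy \<kappa> = (\<Sum>j. ennreal (eta (measure \<kappa> {x. r x = j})))"
proof -
  have sets: "sets \<kappa> = sets borel" and prob: "prob_space \<kappa>"
    using \<kappa> by (auto simp: std_borel_prob_def)
  interpret prob_space \<kappa> by (rule prob)
  have sp: "space \<kappa> = UNIV" using sets_eq_imp_space_eq[OF sets] by simp
  obtain C where C: "countable C" "C \<in> sets \<kappa>" "emeasure \<kappa> C = 1"
    using fin by (auto simp: shannon_entropy_def split: if_splits)
  have cm: "A \<in> sets \<kappa>" if "countable A" for A
    by (rule sets.countable[OF _ that]) (simp add: sets)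
  have AEC: "AE x in \<kappa>. x \<in> C"
    using C by (simp add: AE_in_set_eq_1 emeasure_eq_measure)
  \<comment> \<open>The default 0 may coincide with the code of a point of \<open>C\<close>; this is
    harmless because the complement of \<open>C\<close> is null.\<close>
  define r where "r x = (if x \<in> C then to_nat_on C x else 0)" for x
  define s where "s = from_nat_into C"
  have sr: "s (r x) = x" if "x \<in> C" for x
    using that C(1) by (simp add: r_def s_def)
  have r: "r \<in> measurable \<kappa> (count_space UNIV)"
  proof -
    have "r -` {j} \<in> sets \<kappa>" for j
    proof -
      have "r -` {j} = {x \<in> C. to_nat_on C x = j} \<union> (if j = 0 then - C else {})"
        by (auto simp: r_def split: if_splits)
      moreover have "{x \<in> C. to_nat_on C x = j} \<in> sets \<kappa>"
        using C(1) by (intro cm countable_subset[OF _ C(1)]) auto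
      moreover have "- C \<in> sets \<kappa>"
        using sets.compl_sets[OF C(2)] by (simp add: sp Compl_eq_Diff_UNIV)
      ultimately show ?thesis by auto
    qed
    then show ?thesis
      by (simp add: measurable_count_space_eq2_countable sp)
  qed
  have rm: "{x. r x = j} \<in> sets \<kappa>" for j
    using measurable_sets[OF r, of "{j}"] by (simp add: vimage_def sp)
  have out: "prob {k} = 0" if "k \<notin> C" for k
  proof -
    have "prob {k} = prob {}"
      using AEC that by (intro finite_measure_eq_AE cm) auto
    then show ?thesis by simp
  qed
  have "shannon_entropy \<kappa> = (\<integral>\<^sup>+ k. ennreal (eta (prob {k})) \<partial>count_space UNIV)"
    using C by (auto simp: shannon_entropy_def eta_def)
  also have "\<dots> = (\<integral>\<^sup>+ k. ennreal (eta (prob {k})) \<partial>count_space C)"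
    by (rule nn_integral_count_space_eq) (auto simp: out)
  also have "\<dots> = (\<integral>\<^sup>+ k. ennreal (eta (prob {x. r x = r k})) \<partial>count_space C)"
  proof (rule nn_integral_cong)
    fix k assume "k \<in> space (count_space C)"
    then have k: "k \<in> C" by simp
    have "prob {k} = prob {x. r x = r k}"
      using AEC by (intro finite_measure_eq_AE cm rm) (auto elim!: eventually_mono dest: sr simp: sr[OF k] arg_cong[where f=s])
    then show "ennreal (eta (prob {k})) = ennreal (eta (prob {x. r x = r k}))" by simp
  qed
  also have "\<dots> = (\<integral>\<^sup>+ j. ennreal (eta (prob {x. r x = j})) \<partial>count_space (r ` C))"
    by (rule nn_integral_bij_count_space) (metis inj_on_imp_bij_betw inj_on_inverseI sr)
  also have "\<dots> = (\<integral>\<^sup>+ j. ennreal (eta (prob {x. r x = j})) \<partial>count_space UNIV)"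
  proof (rule nn_integral_count_space_eq)
    fix j assume "j \<in> UNIV - r ` C"
    then have "prob {x. r x = j} = prob {}"
      using AEC by (intro finite_measure_eq_AE rm) auto
    then show "ennreal (eta (prob {x. r x = j})) = 0" by simp
  qed auto
  also have "\<dots> = (\<Sum>j. ennreal (eta (prob {x. r x = j})))"
    by (rule nn_integral_count_space_nat)
  finally have "shannon_entropy \<kappa> = (\<Sum>j. ennreal (eta (prob {x. r x = j})))" .
  moreover have "AE x in \<kappa>. s (r x) = x"
    using AEC by eventually_elim (rule sr)
  ultimately show ?thesis
    using that[OF r, of s] by simp
qed

lemma suminf_ennreal_le:
  assumes f: "\<And>j. 0 \<le> f j" and g: "\<And>j. 0 \<le> g j" and fin: "(\<Sum>j. ennreal (g j)) < \<infinity>"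
    and le: "\<And>S N. (\<And>n. (\<Sum>j<n. g j) \<le> S) \<Longrightarrow> (\<Sum>j<N. f j) \<le> S"
  shows "(\<Sum>j. ennreal (f j)) \<le> (\<Sum>j. ennreal (g j))"
proof -
  obtain S where S: "(\<Sum>j. ennreal (g j)) = ennreal S" "0 \<le> S"
    using fin by (cases "\<Sum>j. ennreal (g j)") auto
  have "(\<Sum>j<n. g j) \<le> S" for n
  proof -
    have "ennreal (\<Sum>j<n. g j) = (\<Sum>j<n. ennreal (g j))" using g by (simp add: sum_ennreal)
    also have "\<dots> \<le> ennreal S" unfolding S(1)[symmetric] by (rule sum_le_suminf) auto
    finally show ?thesis using S(2) by simp
  qed
  then have "(\<Sum>j<N. f j) \<le> S" for N by (rule le)
  then have "(\<Sum>j<N. ennreal (f j)) \<le> ennreal S" for N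
    using f by (simp add: sum_ennreal ennreal_leI)
  then show ?thesis
    unfolding S(1) suminf_eq_SUP by (intro SUP_least)
qed

section \<open>Conjugacies\<close>

text \<open>An image under the inverse is a preimage under \<open>\<phi>\<close>, hence measurable,
  and the measure identity for \<open>\<phi>\<close> applies to it.\<close>

lemma measure_space_iso_sym:
  assumes iso: "measure_space_iso M N X Y \<phi>"
  shows "measure_space_iso N M Y X (the_inv_into X \<phi>)"
proof -
  let ?\<psi> = "the_inv_into X \<phi>"
  have X: "X \<in> sets M" and Y: "Y \<in> sets N" and bij: "bij_betw \<phi> X Y"
    and \<phi>: "\<phi> \<in> measurable (restrict_space M X) (restrict_space N Y)"
    and \<psi>: "?\<psi> \<in> measurable (restrict_space N Y) (restrict_space M X)"
    and em: "\<And>A. A \<in> sets M \<Longrightarrow> A \<subseteq> X \<Longrightarrow> emeasure N (\<phi> ` A) = emeasure M A"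
    using iso by (auto simp: measure_space_iso_def)
  have inj: "inj_on \<phi> X" and im: "\<phi> ` X = Y" using bij by (auto simp: bij_betw_def)
  have bij': "bij_betw ?\<psi> Y X" using bij by (rule bij_betw_the_inv_into)
  have inv: "the_inv_into Y ?\<psi> x = \<phi> x" if "x \<in> X" for x
    using that inj im bij' by (intro the_inv_into_f_eq) (auto simp: bij_betw_def the_inv_into_f_f)
  have "the_inv_into Y ?\<psi> \<in> measurable (restrict_space M X) (restrict_space N Y)"
    using \<phi> by (subst measurable_cong[where g = \<phi>]) (auto simp: space_restrict_space inv)
  moreover have "emeasure M (?\<psi> ` A) = emeasure N A" if A: "A \<in> sets N" "A \<subseteq> Y" for A
  proof -
    have eq: "?\<psi> ` A = \<phi> -` A \<inter> space (restrict_space M X)"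
    proof -
      have "?\<psi> ` A = \<phi> -` A \<inter> X"
      proof (intro equalityI subsetI)
        fix x assume "x \<in> ?\<psi> ` A"
        then obtain y where y: "y \<in> A" "x = ?\<psi> y" by blast
        then have "y \<in> \<phi> ` X" using A(2) im by auto
        then show "x \<in> \<phi> -` A \<inter> X"
          using y f_the_inv_into_f[OF inj] the_inv_into_into[OF inj, of y X] by auto
      next
        fix x assume "x \<in> \<phi> -` A \<inter> X"
        then show "x \<in> ?\<psi> ` A" using the_inv_into_f_f[OF inj, of x] by (metis IntE imageI vimageE)
      qed
      then show ?thesis
        using sets.sets_into_space[OF X] by (auto simp: space_restrict_space)
    qed
    have "A \<in> sets (restrict_space N Y)"
      using A Y sets.sets_into_space[OF Y] by (simp add: sets_restrict_space_iff Int_absorb2)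
    then have "?\<psi> ` A \<in> sets (restrict_space M X)"
      unfolding eq by (rule measurable_sets[OF \<phi>])
    then have B: "?\<psi> ` A \<in> sets M" "?\<psi> ` A \<subseteq> X"
      using X sets.sets_into_space[OF X] by (auto simp: sets_restrict_space_iff Int_absorb2)
    have "\<phi> ` (?\<psi> ` A) = A"
      using A(2) im f_the_inv_into_f[OF inj] by (force simp: image_image)
    then show ?thesis using em[OF B] by simp
  qed
  ultimately show ?thesis
    using X Y bij' \<psi> by (simp add: measure_space_iso_def)
qed

lemma group_automorphism_inv:
  assumes "group_automorphism \<Phi>" shows "group_automorphism (inv \<Phi>)"
proof -
  have bij: "bij \<Phi>" and add: "\<And>a b. \<Phi> (a + b) = \<Phi> a + \<Phi> b"
    using assms by (auto simp: group_automorphism_def)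
  have "inv \<Phi> (a + b) = inv \<Phi> a + inv \<Phi> b" for a b
    using bij by (intro inv_f_eq) (auto simp: add bij_is_inj surj_f_inv_f bij_is_surj)
  then show ?thesis
    using bij_imp_bij_inv[OF bij] by (simp add: group_automorphism_def)
qed

text \<open>Invariance of \<open>X2\<close> is not part of the definition but follows: any point of
  \<open>X2\<close> is some \<open>\<phi> x\<close>, and \<open>act2 g\<close> moves it to the image
  of \<open>act1 (inv \<Phi> g) x\<close>, which stays in \<open>X1\<close>.\<close>

lemma conj_up_to_aut_sym:
  assumes "conj_up_to_aut act1 \<mu>1 act2 \<mu>2"
  shows "conj_up_to_aut act2 \<mu>2 act1 \<mu>1"
proof -
  obtain \<Phi> X1 X2 \<phi> where \<Phi>: "group_automorphism \<Phi>"
    and X1: "X1 \<in> sets \<mu>1" "emeasure \<mu>1 (space \<mu>1 - X1) = 0"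
    and X2: "X2 \<in> sets \<mu>2" "emeasure \<mu>2 (space \<mu>2 - X2) = 0"
    and iso: "measure_space_iso \<mu>1 \<mu>2 X1 X2 \<phi>"
    and eq: "\<And>g x. x \<in> X1 \<Longrightarrow> act1 g x \<in> X1 \<and> \<phi> (act1 g x) = act2 (\<Phi> g) (\<phi> x)"
    using assms unfolding conj_up_to_aut_def by blast
  have inj: "inj_on \<phi> X1" and im: "\<phi> ` X1 = X2"
    using iso by (auto simp: measure_space_iso_def bij_betw_def)
  have surj: "\<Phi> (inv \<Phi> g) = g" for g
    using \<Phi> by (simp add: group_automorphism_def bij_is_surj surj_f_inv_f)
  have "act2 g z \<in> X2 \<and> the_inv_into X1 \<phi> (act2 g z) = act1 (inv \<Phi> g) (the_inv_into X1 \<phi> z)"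
    if z: "z \<in> X2" for g z
  proof -
    obtain x where x: "x \<in> X1" "z = \<phi> x" using z im by auto
    have "act2 g z = \<phi> (act1 (inv \<Phi> g) x)" and mem: "act1 (inv \<Phi> g) x \<in> X1"
      using eq[OF x(1), of "inv \<Phi> g"] surj x(2) by auto
    then show ?thesis
      using x im by (auto simp: the_inv_into_f_f[OF inj])
  qed
  then show ?thesis
    unfolding conj_up_to_aut_def
    using X1 X2 group_automorphism_inv[OF \<Phi>] measure_space_iso_sym[OF iso] by blast
qed

text \<open>Turns the image formula on \<open>X\<close> into a push-forward statement for a total
  map: \<open>\<phi>\<close> carries the part of the preimage of \<open>A\<close> inside
  \<open>X\<close> onto \<open>A \<inter> Y\<close>.\<close>

lemma measure_space_iso_distr:
  assumes iso: "measure_space_iso M N X Y \<phi>" and null: "emeasure N (space N - Y) = 0"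
    "emeasure M (space M - X) = 0"
    and \<phi>': "\<phi>' \<in> measurable M N" "\<And>x. x \<in> X \<Longrightarrow> \<phi>' x = \<phi> x"
  shows "distr M N \<phi>' = N"
proof (rule measure_eqI)
  fix A assume "A \<in> sets (distr M N \<phi>')"
  then have A: "A \<in> sets N" by simp
  have X: "X \<in> sets M" and Y: "Y \<in> sets N" and bij: "bij_betw \<phi> X Y"
    and em: "\<And>A. A \<in> sets M \<Longrightarrow> A \<subseteq> X \<Longrightarrow> emeasure N (\<phi> ` A) = emeasure M A"
    using iso by (auto simp: measure_space_iso_def)
  have m: "\<phi>' -` A \<inter> space M \<in> sets M" using \<phi>'(1) A by (rule measurable_sets)
  have AEX: "AE x in M. x \<in> X" and AEY: "AE y in N. y \<in> Y"
    using null X Y by (auto intro!: AE_I[where N = "space M - X"] AE_I[where N = "space N - Y"])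
  have "emeasure (distr M N \<phi>') A = emeasure M (\<phi>' -` A \<inter> space M)"
    using \<phi>'(1) A by (rule emeasure_distr)
  also have "\<dots> = emeasure M (\<phi>' -` A \<inter> space M \<inter> X)"
    using AEX m X by (intro emeasure_eq_AE) auto
  also have "\<dots> = emeasure N (\<phi> ` (\<phi>' -` A \<inter> space M \<inter> X))"
    using m X by (intro em[symmetric]) auto
  also have "\<phi> ` (\<phi>' -` A \<inter> space M \<inter> X) = A \<inter> Y"
    using bij sets.sets_into_space[OF X] \<phi>'(2) by (force simp: bij_betw_def)
  also have "emeasure N (A \<inter> Y) = emeasure N A"
    using AEY A Y by (intro emeasure_eq_AE) auto
  finally show "emeasure (distr M N \<phi>') A = emeasure N A" .
qed simp

text \<open>After integer coding, the identity coordinate of the second system becomes a generating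
  observable of the first whose atoms have the masses of \<open>\<kappa>2\<close>.\<close>

lemma conj_entropy_le:
  fixes \<kappa>1 :: "'k1::polish_space measure" and \<kappa>2 :: "'k2::polish_space measure"
  assumes sofic: "sofic TYPE('g::{group_add, countable})"
    and \<kappa>1: "std_borel_prob \<kappa>1" "shannon_entropy \<kappa>1 < \<infinity>"
    and \<kappa>2: "std_borel_prob \<kappa>2" "shannon_entropy \<kappa>2 < \<infinity>"
    and conj: "conj_up_to_aut (shift :: 'g \<Rightarrow> ('g \<Rightarrow> 'k1) \<Rightarrow> _) (bernoulli_measure \<kappa>1)
                        (shift :: 'g \<Rightarrow> ('g \<Rightarrow> 'k2) \<Rightarrow> _) (bernoulli_measure \<kappa>2)"
  shows "shannon_entropy \<kappa>1 \<le> shannon_entropy \<kappa>2"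
proof -
  let ?\<mu>1 = "PiM UNIV (\<lambda>_::'g. \<kappa>1)" and ?\<mu>2 = "PiM UNIV (\<lambda>_::'g. \<kappa>2)"
  obtain \<Phi> X1 X2 \<phi> where \<Phi>: "group_automorphism \<Phi>"
    and X1: "X1 \<in> sets ?\<mu>1" "emeasure ?\<mu>1 (space ?\<mu>1 - X1) = 0"
    and X2: "X2 \<in> sets ?\<mu>2" "emeasure ?\<mu>2 (space ?\<mu>2 - X2) = 0"
    and iso: "measure_space_iso ?\<mu>1 ?\<mu>2 X1 X2 \<phi>"
    and eq: "\<And>g x. x \<in> X1 \<Longrightarrow> shift g x \<in> X1" "\<And>g x. x \<in> X1 \<Longrightarrow> \<phi> (shift g x) = shift (\<Phi> g) (\<phi> x)"
    using conj unfolding conj_up_to_aut_def bernoulli_measure_def by blast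
  obtain r1 s1 where r1: "r1 \<in> measurable \<kappa>1 (count_space UNIV)" and sr1: "AE x in \<kappa>1. s1 (r1 x :: nat) = x"
    and H1: "shannon_entropy \<kappa>1 = (\<Sum>j. ennreal (eta (measure \<kappa>1 {x. r1 x = j})))"
    using shannon_entropy_coding[OF \<kappa>1] by blast
  obtain r2 s2 where r2: "r2 \<in> measurable \<kappa>2 (count_space UNIV)" and sr2: "AE x in \<kappa>2. s2 (r2 x :: nat) = x"
    and H2: "shannon_entropy \<kappa>2 = (\<Sum>j. ennreal (eta (measure \<kappa>2 {x. r2 x = j})))"
    using shannon_entropy_coding[OF \<kappa>2] by blast
  have p1: "prob_space \<kappa>1" and p2: "prob_space \<kappa>2"
    using \<kappa>1 \<kappa>2 by (auto simp: std_borel_prob_def)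
  have sp1: "space \<kappa>1 = UNIV" and sp2: "space \<kappa>2 = UNIV"
    using \<kappa>1(1) \<kappa>2(1) sets_eq_imp_space_eq[of \<kappa>1 borel] sets_eq_imp_space_eq[of \<kappa>2 borel]
    by (auto simp: std_borel_prob_def)
  have SP: "space ?\<mu>1 = UNIV" "space ?\<mu>2 = UNIV"
    using sp1 sp2 by (auto intro!: space_PiM_UNIV)
  have inj: "inj_on \<phi> X1" and im: "\<phi> ` X1 = X2"
    using iso by (auto simp: measure_space_iso_def bij_betw_def)
  interpret M1: prob_space ?\<mu>1 using p1 by (intro prob_space_PiM)
  define \<phi>' where "\<phi>' x = (if x \<in> X1 then \<phi> x else (\<lambda>_. undefined))" for x
  \<comment> \<open>Total versions of the conjugacy and its inverse; the defaults matter only on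
    null sets.\<close>
  define \<theta>' where "\<theta>' z = (if z \<in> X2 then the_inv_into X1 \<phi> z else (\<lambda>_. undefined))" for z
  have \<phi>'m: "\<phi>' \<in> measurable ?\<mu>1 ?\<mu>2"
  proof -
    have "\<phi> \<in> measurable (restrict_space ?\<mu>1 X1) ?\<mu>2"
      using iso by (auto simp: measure_space_iso_def measurable_restrict_space2_iff)
    then show ?thesis
      unfolding \<phi>'_def[abs_def] using X1 by (subst (asm) measurable_restrict_space_iff) (auto simp: SP)
  qed
  have \<theta>'m: "\<theta>' \<in> measurable ?\<mu>2 ?\<mu>1"
  proof -
    have "the_inv_into X1 \<phi> \<in> measurable (restrict_space ?\<mu>2 X2) ?\<mu>1"
      using iso by (auto simp: measure_space_iso_def measurable_restrict_space2_iff)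
    then show ?thesis
      unfolding \<theta>'_def[abs_def] using X2 by (subst (asm) measurable_restrict_space_iff) (auto simp: SP)
  qed
  have law: "distr ?\<mu>1 ?\<mu>2 \<phi>' = ?\<mu>2"
    by (rule measure_space_iso_distr[OF iso X2(2) X1(2) \<phi>'m]) (simp add: \<phi>'_def)
  define R1 where "R1 x g = r1 (x g)" for x :: "'g \<Rightarrow> 'k1" and g
  define p where "p = distr \<kappa>1 (count_space UNIV) r1"
  \<comment> \<open>Decode the labels, apply the conjugacy, and encode the identity coordinate. The
    decoder \<open>c\<close> does the reverse; coordinate \<open>h\<close> of the image sits at the
    translate \<open>inv \<Phi> h\<close> by the identity \<open>bR\<close> below.\<close>
  define b where "b u = r2 (\<phi>' (\<lambda>g. s1 (u g)) 0)" for u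
  define c where "c w = r1 (\<theta>' (\<lambda>h. s2 (w (inv \<Phi> h))) 0)" for w
  have R1m: "R1 \<in> measurable ?\<mu>1 config"
    unfolding R1_def[abs_def] by (intro measurable_PiM_single') (auto intro: measurable_compose[OF _ r1])
  have \<mu>p: "PiM UNIV (\<lambda>_::'g. p) = distr ?\<mu>1 config R1"
    unfolding p_def R1_def[abs_def] by (rule PiM_distr_count_space[OF p1 sp1 r1, symmetric])
  have s1m: "(\<lambda>u g. s1 (u g)) \<in> measurable config ?\<mu>1"
    by (intro measurable_PiM_single' measurable_compose[OF measurable_component_singleton, of _ UNIV "\<lambda>_. count_space UNIV"])
      (auto simp: sp1)
  have s2m: "(\<lambda>w h. s2 (w (inv \<Phi> h))) \<in> measurable config ?\<mu>2"
    by (intro measurable_PiM_single' measurable_compose[OF measurable_component_singleton, of _ UNIV "\<lambda>_. count_space UNIV"])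
      (auto simp: sp2)
  have bm: "b \<in> measurable config (count_space UNIV)"
    unfolding b_def[abs_def]
    by (rule measurable_compose[OF measurable_compose[OF measurable_compose[OF s1m \<phi>'m] measurable_component_singleton] r2]) simp
  have cm: "c \<in> measurable config (count_space UNIV)"
    unfolding c_def[abs_def]
    by (rule measurable_compose[OF measurable_compose[OF measurable_compose[OF s2m \<theta>'m] measurable_component_singleton] r1]) simp
  have AE1: "AE x in ?\<mu>1. x \<in> X1"
    using X1 by (intro AE_I[where N = "space ?\<mu>1 - X1"]) auto
  \<comment> \<open>Countability of the group lets one null set serve all coordinates.\<close>
  have AE2: "AE x in ?\<mu>1. \<forall>g. s1 (r1 (x g)) = x g"
    unfolding AE_all_countable using p1 sr1 by (intro allI AE_PiM_component) auto
  have "AE z in ?\<mu>2. \<forall>g. s2 (r2 (z g)) = z g"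
    unfolding AE_all_countable using p2 sr2 by (intro allI AE_PiM_component) auto
  then have AE3: "AE x in ?\<mu>1. \<forall>g. s2 (r2 (\<phi>' x g)) = \<phi>' x g"
    by (rule AE_distrD[OF \<phi>'m, unfolded law])
  \<comment> \<open>Reading \<open>x\<close> from position \<open>g\<close> is the shift by
    \<open>- g\<close>, which the conjugacy turns into the shift by \<open>\<Phi> (- g)\<close>; its
    identity coordinate is coordinate \<open>\<Phi> g\<close>.\<close>
  have bR: "b (\<lambda>f. R1 x (g + f)) = r2 (\<phi> x (\<Phi> g))" if x: "x \<in> X1" "\<forall>g. s1 (r1 (x g)) = x g" for x g
  proof -
    have "(\<lambda>f. s1 (R1 x (g + f))) = shift (- g) x"
      using x(2) by (simp add: R1_def shift_def)
    then have "b (\<lambda>f. R1 x (g + f)) = r2 (\<phi> (shift (- g) x) 0)"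
      using eq(1)[OF x(1)] by (simp add: b_def \<phi>'_def)
    also have "\<phi> (shift (- g) x) 0 = \<phi> x (\<Phi> g)"
    proof -
      have add: "\<Phi> (a + b) = \<Phi> a + \<Phi> b" for a b using \<Phi> by (simp add: group_automorphism_def)
      have "\<Phi> 0 = 0" using add[of 0 0] by (metis add.right_neutral add_left_cancel)
      then have "\<Phi> (- g) + \<Phi> g = 0" using add[of "- g" g] by simp
      then have "- \<Phi> (- g) = \<Phi> g" by (rule minus_unique)
      then show ?thesis using eq(2)[OF x(1), of "- g"] by (simp add: shift_def)
    qed
    finally show ?thesis .
  qed
  have pp: "prob_space p" "sets p = sets (count_space UNIV)"
    unfolding p_def using prob_space.prob_space_distr[OF p1 r1] by auto
  have codem: "(\<lambda>u g. b (\<lambda>f. u (g + f))) \<in> measurable config config"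
  proof -
    have "(\<lambda>u. b (\<lambda>f. u (g + f))) \<in> measurable config (count_space UNIV)" for g
      by (rule measurable_compose[OF measurable_PiM_reindex[of "(+) g"] bm])
    then show ?thesis by (intro measurable_PiM_single') (auto simp: space_PiM)
  qed
  have gen: "AE u in PiM UNIV (\<lambda>_. p). c (\<lambda>g. b (\<lambda>f. u (g + f))) = u 0"
  proof -
    note [measurable] = measurable_compose[OF codem cm]
    \<comment> \<open>The common value is named so that the equality set becomes a countable union
      of measurable pieces.\<close>
    have "{u \<in> space config. \<exists>n. c (\<lambda>g. b (\<lambda>f. u (g + f))) = n \<and> u 0 = n} \<in> sets config"
      by measurable
    then have m: "{u \<in> space config. c (\<lambda>g. b (\<lambda>f. u (g + f))) = u 0} \<in> sets config"
      by (simp add: eq_commute)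
    have "AE x in ?\<mu>1. c (\<lambda>g. b (\<lambda>f. R1 x (g + f))) = R1 x 0"
      using AE1 AE2 AE3
    proof eventually_elim
      case (elim x)
      then have "(\<lambda>h. s2 (b (\<lambda>f. R1 x (inv \<Phi> h + f)))) = \<phi> x"
        using \<Phi> by (auto simp: bR \<phi>'_def group_automorphism_def bij_is_surj surj_f_inv_f)
      then show ?case
        using elim(1) im the_inv_into_f_f[OF inj elim(1)] by (auto simp: c_def \<theta>'_def R1_def)
    qed
    then show ?thesis
      unfolding \<mu>p by (subst AE_distr_iff[OF R1m m])
  qed
  interpret G: generating_observable p b c
    by (rule generating_observable.intro[OF sofic pp bm cm gen])
  \<comment> \<open>The conjugacy preserves measure, so \<open>b\<close> has the law of one encoded
    coordinate under \<open>\<kappa>2\<close>.\<close>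
  have bmeas: "measure (PiM UNIV (\<lambda>_. p)) {u. b u = j} = measure \<kappa>2 {k. r2 k = j}" for j
  proof -
    have bj: "{u. b u = j} \<in> sets config"
      using measurable_sets[OF bm, of "{j}"] by (simp add: vimage_def space_PiM)
    have r2j: "{k. r2 k = j} \<in> sets \<kappa>2"
      using measurable_sets[OF r2, of "{j}"] by (simp add: vimage_def sp2)
    have zj: "{z. r2 (z 0) = j} \<in> sets ?\<mu>2"
      using measurable_sets[OF measurable_component_singleton[of "0::'g" UNIV "\<lambda>_. \<kappa>2"] r2j]
      by (simp add: vimage_def SP)
    have xj: "{x. r2 (\<phi>' x 0) = j} \<in> sets ?\<mu>1"
      using measurable_sets[OF \<phi>'m zj] by (simp add: vimage_def SP)
    have xj': "{x. b (R1 x) = j} \<in> sets ?\<mu>1"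
      using measurable_sets[OF R1m bj] by (simp add: vimage_def SP)
    have "measure (PiM UNIV (\<lambda>_. p)) {u. b u = j} = M1.prob {x. b (R1 x) = j}"
      unfolding \<mu>p by (subst measure_distr[OF R1m bj]) (simp add: vimage_def SP)
    also have "\<dots> = M1.prob {x. r2 (\<phi>' x 0) = j}"
      using AE2 by (intro M1.finite_measure_eq_AE xj xj') (auto simp: b_def R1_def)
    also have "\<dots> = measure (distr ?\<mu>1 ?\<mu>2 \<phi>') {z. r2 (z 0) = j}"
      by (subst measure_distr[OF \<phi>'m zj]) (simp add: vimage_def SP)
    also have "\<dots> = measure \<kappa>2 {k. r2 k = j}"
      unfolding law using measure_PiM_cylinder[OF p2 sp2, of "{0}" "\<lambda>_. {k. r2 k = j}"] r2j by simp
    finally show ?thesis .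
  qed
  have pj: "measure p {j} = measure \<kappa>1 {x. r1 x = j}" for j
    unfolding p_def by (subst measure_distr[OF r1]) (auto simp: vimage_def sp1)
  show ?thesis
    unfolding H1 H2
  proof (rule suminf_ennreal_le)
    show "0 \<le> eta (measure \<kappa>1 {x. r1 x = j})" "0 \<le> eta (measure \<kappa>2 {x. r2 x = j})" for j
      using prob_space.prob_le_1[OF p1] prob_space.prob_le_1[OF p2] by (simp_all add: eta_nonneg)
    show "(\<Sum>j. ennreal (eta (measure \<kappa>2 {x. r2 x = j}))) < \<infinity>"
      using \<kappa>2(2) by (simp only: H2)
    show "(\<Sum>j<N. eta (measure \<kappa>1 {x. r1 x = j})) \<le> S"
      if "\<And>n. (\<Sum>j<n. eta (measure \<kappa>2 {x. r2 x = j})) \<le> S" for S N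
      using G.generating_entropy_le[of S N] that by (simp add: bmeas pj)
  qed
qed

theorem theorem1p10:
  fixes \<kappa>1 :: "'k1::polish_space measure" and \<kappa>2 :: "'k2::polish_space measure"
  assumes "sofic TYPE('g::{group_add, countable})"
    and "std_borel_prob \<kappa>1" and "std_borel_prob \<kappa>2"
    and "shannon_entropy \<kappa>1 + shannon_entropy \<kappa>2 < \<infinity>"
    and "conj_up_to_aut (shift :: 'g \<Rightarrow> ('g \<Rightarrow> 'k1) \<Rightarrow> _) (bernoulli_measure \<kappa>1)
                        (shift :: 'g \<Rightarrow> ('g \<Rightarrow> 'k2) \<Rightarrow> _) (bernoulli_measure \<kappa>2)"
  shows "shannon_entropy \<kappa>1 = shannon_entropy \<kappa>2"
proof (rule antisym)
  have fin: "shannon_entropy \<kappa>1 < \<infinity>" "shannon_entropy \<kappa>2 < \<infinity>"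
    using assms(4) by (auto simp: less_top[symmetric])
  show "shannon_entropy \<kappa>1 \<le> shannon_entropy \<kappa>2"
    by (rule conj_entropy_le[OF assms(1,2) fin(1) assms(3) fin(2) assms(5)])
  show "shannon_entropy \<kappa>2 \<le> shannon_entropy \<kappa>1"
    by (rule conj_entropy_le[OF assms(1,3) fin(2) assms(2) fin(1) conj_up_to_aut_sym[OF assms(5)]])
qed

end
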